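(* Let $\varepsilon>0$, let $m\ge 1$ be an integer, let $f\in C^{m+1}([0,1])$, and let $u$ be the exact solution of $-\varepsilon u''(x)+u'(x)=f(x)$ for $0<x<1$, $u(0)=u(1)=0$. Let a quadrature rule of order $O(h^{m+1})$ on each mesh interval be fixed, and for each integer $n\ge2$, with $h=1/n$, let $u_h^{FD}\in\mathcal{M}_h$ be the solution of the upwinding finite difference method obtained from the exponential bubble Petrov-Galerkin finite element method by using this quadrature on each mesh interval to approximate the dual vector $\left[\int_0^1 f g_1\,dx,\dots,\int_0^1 f g_{n-1}\,dx\right]^T$. Then there is a constant $C$, independent of $h$, (depending on $f$ and its derivatives, on the exponential bubble and its derivatives, i.e. on $\varepsilon$, and on $m$ and the quadrature rule) such that for all $n\ge 2$ $$\|I_h(u)-u_h^{FD}\|_{*,h}\le C\,h^m .$$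
   Context: Mesh and spaces: for an integer $n\ge2$ let $h=1/n$, $x_j=jh$ ($j=0,\dots,n$). For $j=1,\dots,n-1$, $\varphi_j$ is the nodal hat function: continuous on $[0,1]$, linear on each $[x_{i-1},x_i]$, $\varphi_j(x_i)=\delta_{ij}$. Put $\mathcal{M}_h=\mathrm{span}\{\varphi_j\}_{j=1}^{n-1}$. $I_h(u)$ is the continuous piecewise linear interpolant of $u$ on the nodes $x_0,\dots,x_n$. Exponential bubbles: $B:[0,h]\to\mathbb{R}$ is the unique solution of $-\varepsilon B''-B'=1/h$, $B(0)=B(h)=0$. For $i=1,\dots,n$, $B_i(x)=B(x-x_{i-1})$ on $[x_{i-1},x_i]$ and $B_i=0$ elsewhere on $[0,1]$. Put $g_j=\varphi_j+B_j-B_{j+1}$ for $j=1,\dots,n-1$. Quadrature: a quadrature rule is a fixed rule with finitely many nodes and weights on a reference interval, transported affinely to each mesh interval $[x_{i-1},x_i]$, giving a linear functional $Q_i$. It is of order $O(h^{m+1})$ on each mesh interval if there is a constant $C_Q$, independent of $i$ and $n$, such that $\left|\int_{x_{i-1}}^{x_i}F\,dx-Q_i(F)\right|\le C_Q\,h^{m+1}\max_{0\le k\le m+1}\max_{[x_{i-1},x_i]}|F^{(k)}|$ for all $F\in C^{m+1}([x_{i-1},x_i])$. Upwinding finite difference method: let $g_0=\tanh\left(\frac{h}{2\varepsilon}\right)$ (a number, not one of the functions $g_j$, $j\ge1$). The exponential bubble Petrov-Galerkin method has the $(n-1)\times(n-1)$ tridiagonal matrix $M$ with diagonal entries $\frac1{g_0}$,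 subdiagonal entries $-\frac{1+g_0}{2g_0}$ and superdiagonal entries $-\frac{1-g_0}{2g_0}$, and right-hand side (dual vector) with entries $\int_0^1 f g_j\,dx$. The finite difference method solves $MU=G$ with $G_j=Q_j(f g_j)+Q_{j+1}(f g_j)$, and $u_h^{FD}=\sum_{j=1}^{n-1}U_j\varphi_j$. Discrete optimal trial norm: for $u_h\in\mathcal{M}_h$, $$\|u_h\|_{*,h}=\sup_{0\ne w_h\in\mathcal{M}_h}\frac{d\int_0^1u_h'w_h'\,dx+\int_0^1u_h'w_h\,dx}{|w_h|},\qquad d=\frac{h}{2g_0},\quad |w_h|^2=\int_0^1 (w_h')^2\,dx,$$ equivalently $$\|u_h\|_{*,h}^2=\left(\frac{h}{2g_0}\right)^2|u_h|^2+\frac1n\sum_{i=1}^n\left(\frac1h\int_{x_{i-1}}^{x_i}u_h\,dx\right)^2-\left(\int_0^1u_h\,dx\right)^2 .$$ *)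

theory Defs
  imports "HOL-Analysis.Analysis"
begin

section \<open>Smoothness and boundary value problems\<close>

text \<open>Derivatives are taken within the set \<open>S\<close>, so they are one-sided at the endpoints of a
  compact interval.\<close>

primrec iter_deriv :: "real set \<Rightarrow> nat \<Rightarrow> (real \<Rightarrow> real) \<Rightarrow> real \<Rightarrow> real" where
  "iter_deriv S 0 F = F"
| "iter_deriv S (Suc k) F = (\<lambda>x. vector_derivative (iter_deriv S k F) (at x within S))"

definition Ck_on :: "nat \<Rightarrow> (real \<Rightarrow> real) \<Rightarrow> real set \<Rightarrow> bool" where
  "Ck_on k F S \<longleftrightarrow>
     (\<forall>j<k. iter_deriv S j F differentiable_on S) \<and>
     (\<forall>j\<le>k. continuous_on S (iter_deriv S j F))"

text \<open>Classical solution (continuous on \<open>[0,L]\<close>, twice differentiable on \<open>(0,L)\<close>) of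
  \<open>-\<epsilon> y'' + b y' = r\<close> on \<open>(0,L)\<close> with \<open>y(0) = y(L) = 0\<close>.\<close>

definition dirichlet_solution ::
    "real \<Rightarrow> real \<Rightarrow> (real \<Rightarrow> real) \<Rightarrow> real \<Rightarrow> (real \<Rightarrow> real) \<Rightarrow> bool" where
  "dirichlet_solution \<epsilon> b r L y \<longleftrightarrow>
     continuous_on {0..L} y \<and> y 0 = 0 \<and> y L = 0 \<and>
     (\<forall>x\<in>{0<..<L}. y differentiable (at x) \<and> deriv y differentiable (at x) \<and>
        - \<epsilon> * deriv (deriv y) x + b * deriv y x = r x)"


section \<open>Mesh and piecewise linear functions\<close>

definition mesh :: "nat \<Rightarrow> real" where
  "mesh n = 1 / real n"

definition node :: "nat \<Rightarrow> nat \<Rightarrow> real" where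
  "node n j = real j * mesh n"

text \<open>The formula also gives the two boundary hat functions \<open>j = 0\<close> and \<open>j = n\<close>, which are needed
  for the interpolant. For \<open>0 < j < n\<close> the function vanishes outside \<open>[0,1]\<close>. The three lemmas below
  are the defining properties of the nodal basis.\<close>

definition hat :: "nat \<Rightarrow> nat \<Rightarrow> real \<Rightarrow> real" where
  "hat n j x = max 0 (1 - \<bar>x - node n j\<bar> / mesh n)"

lemma hat_node:
  assumes "n \<ge> 1"
  shows "hat n j (node n i) = (if i = j then 1 else 0)"
proof -
  have "hat n j (node n i) = max 0 (1 - \<bar>real i - real j\<bar>)"
    using assms by (simp add: hat_def node_def mesh_def abs_divide flip: diff_divide_distrib)
  thus ?thesis by (auto simp: max_def)
qed

lemma continuous_on_hat: "continuous_on S (hat n j)"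
  unfolding hat_def by (cases "n = 0") (auto simp: mesh_def intro!: continuous_intros)

lemma hat_linear_on_cells:
  assumes "n \<ge> 1" "i \<in> {1..n}"
  shows "\<exists>a b. \<forall>x\<in>{node n (i - 1)..node n i}. hat n j x = a + b * x"
proof -
  have h: "hat n j x = max 0 (1 - \<bar>real n * x - real j\<bar>)" for x
  proof -
    have "x - node n j = (real n * x - real j) / real n"
      using assms by (simp add: node_def mesh_def field_simps)
    thus ?thesis using assms by (simp add: hat_def mesh_def abs_divide)
  qed
  have cell: "real i - 1 \<le> real n * x \<and> real n * x \<le> real i"
    if "x \<in> {node n (i - 1)..node n i}" for x
    using that assms by (auto simp: node_def mesh_def field_simps of_nat_diff)
  consider "i < j" | "i = j" | "i = Suc j" | "i \<ge> Suc (Suc j)" by linarith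
  thus ?thesis
  proof cases
    case 1
    have rel: "real i + 1 \<le> real j" using 1 by linarith
    have "hat n j x = 0 + 0 * x" if "x \<in> {node n (i - 1)..node n i}" for x
      using cell[OF that] rel unfolding h by linarith
    thus ?thesis by blast
  next
    case 2
    have rel: "real i = real j" using 2 by simp
    have "hat n j x = (1 - real j) + real n * x" if "x \<in> {node n (i - 1)..node n i}" for x
      using cell[OF that] rel unfolding h by linarith
    thus ?thesis by blast
  next
    case 3
    have rel: "real i = real j + 1" using 3 by simp
    have "hat n j x = (1 + real j) + (- real n) * x" if "x \<in> {node n (i - 1)..node n i}" for x
      using cell[OF that] rel unfolding h by linarith
    thus ?thesis by blast
  next
    case 4
    have rel: "real j + 2 \<le> real i" using 4 by linarith
    have "hat n j x = 0 + 0 * x" if "x \<in> {node n (i - 1)..node n i}" for x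
      using cell[OF that] rel unfolding h by linarith
    thus ?thesis by blast
  qed
qed

definition lin_comb :: "nat \<Rightarrow> (nat \<Rightarrow> real) \<Rightarrow> real \<Rightarrow> real" where
  "lin_comb n c x = (\<Sum>j=1..n-1. c j * hat n j x)"

definition trial_space :: "nat \<Rightarrow> (real \<Rightarrow> real) set" where
  "trial_space n = range (lin_comb n)"

definition pl_interp :: "nat \<Rightarrow> (real \<Rightarrow> real) \<Rightarrow> real \<Rightarrow> real" where
  "pl_interp n u x = (\<Sum>j=0..n. u (node n j) * hat n j x)"


section \<open>Exponential bubbles\<close>

definition exp_bubble :: "real \<Rightarrow> real \<Rightarrow> real \<Rightarrow> real" where
  "exp_bubble \<epsilon> h =
     (THE B. dirichlet_solution \<epsilon> (-1) (\<lambda>_. 1 / h) h B \<and> (\<forall>x. x \<notin> {0..h} \<longrightarrow> B x = 0))"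

lemma exp_bubble_ex1:
  assumes "\<epsilon> > 0" "h > 0"
  shows "\<exists>!B. dirichlet_solution \<epsilon> (-1) (\<lambda>_. 1 / h) h B \<and> (\<forall>x. x \<notin> {0..h} \<longrightarrow> B x = 0)"
proof -
  define K where "K = 1 / (1 - exp (- h / \<epsilon>))"
  define b where "b = (\<lambda>x. K * (1 - exp (- x / \<epsilon>)) - x / h)"
  define b' where "b' = (\<lambda>x. K * exp (- x / \<epsilon>) / \<epsilon> - 1 / h)"
  define b'' where "b'' = (\<lambda>x. - K * exp (- x / \<epsilon>) / \<epsilon>\<^sup>2)"
  define B where "B = (\<lambda>x. if x \<in> {0..h} then b x else 0)"
  have K: "K * (1 - exp (- h / \<epsilon>)) = 1" using assms by (simp add: K_def)
  have db: "(b has_real_derivative b' x) (at x)" for x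
    unfolding b_def b'_def using assms by (auto intro!: derivative_eq_intros simp: field_simps)
  have db': "(b' has_real_derivative b'' x) (at x)" for x
    unfolding b'_def b''_def using assms
    by (auto intro!: derivative_eq_intros simp: field_simps power2_eq_square)
  have dB: "(B has_real_derivative b' x) (at x)" if "x \<in> {0<..<h}" for x
    by (rule has_field_derivative_transform_within_open[OF db, of "{0<..<h}"])
       (use that in \<open>auto simp: B_def\<close>)
  have dB': "(deriv B has_real_derivative b'' x) (at x)" if "x \<in> {0<..<h}" for x
    by (rule has_field_derivative_transform_within_open[OF db', of "{0<..<h}"])
       (use that in \<open>auto simp: DERIV_imp_deriv[OF dB]\<close>)
  have contb: "continuous_on {0..h} b"
    using db by (meson DERIV_continuous continuous_at_imp_continuous_on)
  have sol: "dirichlet_solution \<epsilon> (-1) (\<lambda>_. 1 / h) h B"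
    unfolding dirichlet_solution_def
  proof (intro conjI ballI)
    show "continuous_on {0..h} B" by (rule continuous_on_eq[OF contb]) (simp add: B_def)
    show "B 0 = 0" "B h = 0" using assms K by (auto simp: B_def b_def)
    fix x assume x: "x \<in> {0<..<h}"
    show "B differentiable (at x)" "deriv B differentiable (at x)"
      using dB[OF x] dB'[OF x] unfolding real_differentiable_def by blast+
    have "- \<epsilon> * b'' x + (-1) * b' x = 1 / h"
      unfolding b'_def b''_def using assms by (simp add: power2_eq_square)
    thus "- \<epsilon> * deriv (deriv B) x + - 1 * deriv B x = 1 / h"
      using dB[OF x] dB'[OF x] by (simp add: DERIV_imp_deriv)
  qed
  have uniq: "y x = z x"
    if y: "dirichlet_solution \<epsilon> (-1) (\<lambda>_. 1 / h) h y"
      and z: "dirichlet_solution \<epsilon> (-1) (\<lambda>_. 1 / h) h z"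
      and x: "x \<in> {0..h}" for y z :: "real \<Rightarrow> real" and x
  proof -
    define w where "w = (\<lambda>x. y x - z x)"
    define w' where "w' = (\<lambda>x. deriv y x - deriv z x)"
    have contw: "continuous_on {0..h} w"
      using y z by (auto simp: w_def dirichlet_solution_def intro!: continuous_intros)
    have w0: "w 0 = 0" "w h = 0" using y z by (auto simp: w_def dirichlet_solution_def)
    have dw: "(w has_real_derivative w' t) (at t)" if "t \<in> {0<..<h}" for t
      using y z that unfolding w_def w'_def dirichlet_solution_def
      by (intro derivative_intros) (auto simp: DERIV_deriv_iff_real_differentiable)
    have dw': "(w' has_real_derivative (- w' t / \<epsilon>)) (at t)" if t: "t \<in> {0<..<h}" for t
    proof -
      have dd: "(w' has_real_derivative (deriv (deriv y) t - deriv (deriv z) t)) (at t)"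
        using y z that unfolding w'_def dirichlet_solution_def
        by (intro derivative_intros) (auto simp: DERIV_deriv_iff_real_differentiable)
      have "- \<epsilon> * deriv (deriv y) t - deriv y t = 1 / h"
           "- \<epsilon> * deriv (deriv z) t - deriv z t = 1 / h"
        using y z t by (auto simp: dirichlet_solution_def)
      hence "\<epsilon> * (deriv (deriv y) t - deriv (deriv z) t) = - w' t"
        by (simp add: w'_def algebra_simps)
      hence "deriv (deriv y) t - deriv (deriv z) t = - w' t / \<epsilon>"
        using assms by (simp add: field_simps)
      thus ?thesis using dd by simp
    qed
    define v where "v = (\<lambda>t. \<epsilon> * w' t + w t)"
    have dv: "(v has_real_derivative 0) (at t)" if "t \<in> {0<..<h}" for t
      unfolding v_def using assms that dw dw' by (auto intro!: derivative_eq_intros)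
    define c where "c = v (h / 2)"
    have vc: "v t = c" if "t \<in> {0<..<h}" for t
      unfolding c_def by (rule DERIV_isconst3[of 0 h]) (use assms that dv in auto)
    define k where "k = (\<lambda>t. exp (t / \<epsilon>) * (w t - c))"
    have contk: "continuous_on {0..h} k"
      unfolding k_def using contw assms by (auto intro!: continuous_intros)
    have dk: "(k has_real_derivative 0) (at t)" if "0 < t" "t < h" for t
    proof -
      have "\<epsilon> * w' t = c - w t" using vc[of t] that by (simp add: v_def)
      hence w't: "w' t = (c - w t) / \<epsilon>" using assms by (simp add: field_simps)
      have "(k has_real_derivative (exp (t / \<epsilon>) * (1 / \<epsilon>) * (w t - c) + exp (t / \<epsilon>) * w' t)) (at t)"
        unfolding k_def using assms that dw[of t] by (auto intro!: derivative_eq_intros)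
      thus ?thesis using assms by (simp add: w't field_simps)
    qed
    have kk: "k t = k 0" if "t \<in> {0..h}" for t
      by (rule DERIV_isconst2[of 0 h]) (use assms that contk dk in auto)
    have "exp (h / \<epsilon>) * c = c" using kk[of h] assms w0 by (simp add: k_def)
    hence "c = 0" using assms by simp
    hence "w x = 0" using kk[OF x] w0 by (simp add: k_def)
    thus ?thesis by (simp add: w_def)
  qed
  show ?thesis
  proof (rule ex1I[of _ B])
    show "dirichlet_solution \<epsilon> (-1) (\<lambda>_. 1 / h) h B \<and> (\<forall>x. x \<notin> {0..h} \<longrightarrow> B x = 0)"
      using sol by (simp add: B_def)
  next
    fix A assume A: "dirichlet_solution \<epsilon> (-1) (\<lambda>_. 1 / h) h A \<and> (\<forall>x. x \<notin> {0..h} \<longrightarrow> A x = 0)"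
    show "A = B"
    proof
      fix x show "A x = B x"
        using uniq[of A B x] A sol by (cases "x \<in> {0..h}") (auto simp: B_def)
    qed
  qed
qed

definition cell_bubble :: "real \<Rightarrow> nat \<Rightarrow> nat \<Rightarrow> real \<Rightarrow> real" where
  "cell_bubble \<epsilon> n i x =
     (if x \<in> {node n (i - 1)..node n i} then exp_bubble \<epsilon> (mesh n) (x - node n (i - 1)) else 0)"

definition test_fun :: "real \<Rightarrow> nat \<Rightarrow> nat \<Rightarrow> real \<Rightarrow> real" where
  "test_fun \<epsilon> n j x = hat n j x + cell_bubble \<epsilon> n j x - cell_bubble \<epsilon> n (j + 1) x"


section \<open>Quadrature\<close>

text \<open>A rule on the reference interval \<open>[0,1]\<close> is a list of pairs (node, weight).\<close>

definition quadrature_rule :: "(real \<times> real) list \<Rightarrow> bool" where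
  "quadrature_rule q \<longleftrightarrow> (\<forall>(\<xi>, w) \<in> set q. \<xi> \<in> {0..1})"

definition quad :: "(real \<times> real) list \<Rightarrow> nat \<Rightarrow> nat \<Rightarrow> (real \<Rightarrow> real) \<Rightarrow> real" where
  "quad q n i F = mesh n * (\<Sum>(\<xi>, w)\<leftarrow>q. w * F (node n (i - 1) + mesh n * \<xi>))"

text \<open>The rule is of order \<open>O(h ^ (m + 1))\<close> on each mesh interval. The suprema are maxima, since the
  derivatives are continuous on a compact interval.\<close>

definition quadrature_order :: "(real \<times> real) list \<Rightarrow> nat \<Rightarrow> bool" where
  "quadrature_order q m \<longleftrightarrow>
     (\<exists>CQ. \<forall>n\<ge>2. \<forall>i\<in>{1..n}. \<forall>F. Ck_on (m + 1) F {node n (i - 1)..node n i} \<longrightarrow>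
        \<bar>integral {node n (i - 1)..node n i} F - quad q n i F\<bar>
          \<le> CQ * mesh n ^ (m + 1) *
             (MAX k\<in>{0..m + 1}. SUP x\<in>{node n (i - 1)..node n i}.
                \<bar>iter_deriv {node n (i - 1)..node n i} k F x\<bar>))"


section \<open>Upwinding finite difference method\<close>

definition g0 :: "real \<Rightarrow> nat \<Rightarrow> real" where
  "g0 \<epsilon> n = tanh (mesh n / (2 * \<epsilon>))"

text \<open>Matrix and vector indices range over \<open>1, \<dots>, n - 1\<close>.\<close>

definition fd_matrix :: "real \<Rightarrow> nat \<Rightarrow> nat \<Rightarrow> nat \<Rightarrow> real" where
  "fd_matrix \<epsilon> n j k =
     (if k = j then 1 / g0 \<epsilon> n
      else if j = k + 1 then - (1 + g0 \<epsilon> n) / (2 * g0 \<epsilon> n)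
      else if k = j + 1 then - (1 - g0 \<epsilon> n) / (2 * g0 \<epsilon> n)
      else 0)"

definition fd_rhs :: "real \<Rightarrow> (real \<Rightarrow> real) \<Rightarrow> (real \<times> real) list \<Rightarrow> nat \<Rightarrow> nat \<Rightarrow> real" where
  "fd_rhs \<epsilon> f q n j =
     quad q n j (\<lambda>x. f x * test_fun \<epsilon> n j x) + quad q n (j + 1) (\<lambda>x. f x * test_fun \<epsilon> n j x)"

definition fd_solution ::
    "real \<Rightarrow> (real \<Rightarrow> real) \<Rightarrow> (real \<times> real) list \<Rightarrow> nat \<Rightarrow> (real \<Rightarrow> real) \<Rightarrow> bool" where
  "fd_solution \<epsilon> f q n uh \<longleftrightarrow>
     (\<exists>U. (\<forall>j\<in>{1..n-1}. (\<Sum>k=1..n-1. fd_matrix \<epsilon> n j k * U k) = fd_rhs \<epsilon> f q n j) \<and>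
          uh = lin_comb n U)"


section \<open>Discrete optimal trial norm\<close>

text \<open>Piecewise linear functions are differentiable except at finitely many points, so the
  arbitrary value of \<^const>\<open>deriv\<close> at the mesh nodes does not influence the integrals.\<close>

definition h1_seminorm :: "(real \<Rightarrow> real) \<Rightarrow> real" where
  "h1_seminorm w = sqrt (integral {0..1} (\<lambda>x. (deriv w x)\<^sup>2))"

definition upwind_form :: "real \<Rightarrow> nat \<Rightarrow> (real \<Rightarrow> real) \<Rightarrow> (real \<Rightarrow> real) \<Rightarrow> real" where
  "upwind_form \<epsilon> n u w =
     mesh n / (2 * g0 \<epsilon> n) * integral {0..1} (\<lambda>x. deriv u x * deriv w x)
       + integral {0..1} (\<lambda>x. deriv u x * w x)"

text \<open>For \<open>n \<ge> 2\<close> and \<open>u\<close> in the trial space the supremum is over a nonempty set that is bounded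
  above (by the Cauchy-Schwarz and Poincare inequalities).\<close>

definition optimal_norm :: "real \<Rightarrow> nat \<Rightarrow> (real \<Rightarrow> real) \<Rightarrow> real" where
  "optimal_norm \<epsilon> n u =
     (SUP w\<in>trial_space n - {\<lambda>_. 0}. upwind_form \<epsilon> n u w / h1_seminorm w)"

end

theory Submission
  imports Defs
begin

text \<open>On the cell \<open>[x\<^bsub>i-1\<^esub>, x\<^sub>i]\<close> only two test functions are nonzero, and the linear parts of
  hat and bubble cancel: they are \<open>\<phi>\<^sub>i\<close> and \<open>1 - \<phi>\<^sub>i\<close> with
  \<open>\<phi>\<^sub>i(x) = K (1 - exp (- (x - x\<^bsub>i-1\<^esub>) / \<epsilon>))\<close>, \<open>K = 1 / (1 - exp (- h / \<epsilon>)) = O(1/h)\<close>.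
  Since \<open>\<epsilon> \<phi>\<^sub>i' + \<phi>\<^sub>i = K\<close>, the function \<open>(z - u) \<phi>\<^sub>i + K u\<close> with the continuous flux
  \<open>z = - \<epsilon> u' + u\<close> is an antiderivative of \<open>f \<phi>\<^sub>i\<close>. Hence, with the discrete flux
  \<open>S\<^sub>i(v) = K (v\<^sub>i - v\<^bsub>i-1\<^esub>) - v\<^sub>i\<close>, the integrals of \<open>f \<phi>\<^sub>i\<close> and of \<open>f\<close> over the cell are
  \<open>z(x\<^sub>i) + S\<^sub>i(u)\<close> and \<open>z(x\<^sub>i) - z(x\<^bsub>i-1\<^esub>)\<close> (\<open>integral_on_cell\<close>). As row \<open>j\<close> of the matrix is
  \<open>S\<^sub>j - S\<^bsub>j+1\<^esub>\<close> (\<open>fd_matrix_row\<close>), the nodal values of \<open>u\<close> solve the system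
  whose right-hand side is integrated exactly. So the nodal error \<open>e\<close> solves it with the quadrature errors
  \<open>E\<^sub>i\<close> as right-hand side, and the bilinear form of piecewise linear functions is
  \<open>\<Sum>\<^sub>i (w\<^sub>i - w\<^bsub>i-1\<^esub>) S\<^sub>i(e)\<close> (\<open>upwind_form_lin_comb\<close>).

  Bounding the \<open>n - 1\<close> entries of the right-hand side separately would only give \<open>h ^ (m - 1)\<close>, for each
  \<open>E\<^sub>i(f \<phi>\<^sub>i)\<close> is merely \<open>O(h ^ m)\<close> because of the factor \<open>K\<close>. The missing power comes from collecting the
  terms cell by cell (\<open>upwind_form_error\<close>):
  \<open>form(e, w) = \<Sum>\<^sub>i ((w\<^sub>i - w\<^bsub>i-1\<^esub>) E\<^sub>i(f \<phi>\<^sub>i) + w\<^bsub>i-1\<^esub> E\<^sub>i(f))\<close>. The large errors meet differences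
  of \<open>w\<close>, whose absolute sum is at most \<open>|w|\<close> by Cauchy-Schwarz. The values of \<open>w\<close> meet
  \<open>E\<^sub>i(f) = O(h ^ (m + 1))\<close>, and there are \<open>1/h\<close> of those.\<close>


section \<open>Derivatives on an interval\<close>

text \<open>An explicit list of successive derivatives, continuous up to the last one. Unlike the iterated
  derivative operator it restricts to subsets without any computation, and products can be handled
  by guessing the list.\<close>

definition deriv_chain :: "real set \<Rightarrow> nat \<Rightarrow> (nat \<Rightarrow> real \<Rightarrow> real) \<Rightarrow> bool" where
  "deriv_chain S N D \<longleftrightarrow>
     (\<forall>k<N. \<forall>x\<in>S. (D k has_vector_derivative D (Suc k) x) (at x within S)) \<and>
     continuous_on S (D N)"

lemma deriv_chain_subset:
  assumes "deriv_chain S N D" "T \<subseteq> S"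
  shows "deriv_chain T N D"
  using assms unfolding deriv_chain_def
  by (meson continuous_on_subset has_vector_derivative_within_subset subsetD)

lemma deriv_chain_continuous:
  assumes "deriv_chain S N D" "k \<le> N"
  shows "continuous_on S (D k)"
proof (cases "k = N")
  case False
  with assms have "\<forall>x\<in>S. (D k has_vector_derivative D (Suc k) x) (at x within S)"
    by (simp add: deriv_chain_def)
  thus ?thesis
    by (meson continuous_on_eq_continuous_within has_vector_derivative_continuous)
qed (use assms in \<open>simp add: deriv_chain_def\<close>)

lemma iter_deriv_eq_chain:
  assumes "a < b" "deriv_chain {a..b} N D" "k \<le> N" "x \<in> {a..b}"
  shows "iter_deriv {a..b} k (D 0) x = D k x"
  using assms(3,4)
proof (induction k arbitrary: x)
  case (Suc k)
  have "(D k has_vector_derivative D (Suc k) x) (at x within {a..b})"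
    using assms(2) Suc.prems by (simp add: deriv_chain_def)
  hence "(iter_deriv {a..b} k (D 0) has_vector_derivative D (Suc k) x) (at x within {a..b})"
    by (rule has_vector_derivative_transform[rotated 2]) (use Suc in auto)
  thus ?case
    using vector_derivative_within_cbox[of a b x] assms(1) Suc.prems by (simp add: cbox_interval)
qed simp

lemma Ck_on_chain:
  assumes "a < b" "deriv_chain {a..b} N D"
  shows "Ck_on N (D 0) {a..b}"
  unfolding Ck_on_def
proof (intro conjI allI impI)
  fix j assume j: "j < N"
  have "(iter_deriv {a..b} j (D 0) has_vector_derivative D (Suc j) x) (at x within {a..b})"
    if x: "x \<in> {a..b}" for x
  proof -
    have "(D j has_vector_derivative D (Suc j) x) (at x within {a..b})"
      using assms(2) j x by (simp add: deriv_chain_def)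
    thus ?thesis
      by (rule has_vector_derivative_transform[rotated 2])
         (use x j iter_deriv_eq_chain[OF assms] in auto)
  qed
  thus "iter_deriv {a..b} j (D 0) differentiable_on {a..b}"
    unfolding differentiable_on_def using differentiableI_vector by blast
next
  fix j assume "j \<le> N"
  thus "continuous_on {a..b} (iter_deriv {a..b} j (D 0))"
    using continuous_on_eq[OF deriv_chain_continuous[OF assms(2)]] iter_deriv_eq_chain[OF assms]
    by metis
qed

lemma deriv_chain_iter_deriv:
  assumes "Ck_on N F S"
  shows "deriv_chain S N (\<lambda>k. iter_deriv S k F)"
  using assms unfolding deriv_chain_def Ck_on_def differentiable_on_def
  by (simp add: vector_derivative_works)

text \<open>Since \<open>(exp (- a x) f)' = exp (- a x) (f' - a f)\<close>, the derivatives of the product are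
  \<open>exp (- a x) (d/dx - a)\<^sup>k f\<close>. Below, \<open>shifted_deriv a D k j\<close> is \<open>(d/dx - a)\<^sup>k\<close> applied to the
  \<open>j\<close>-th derivative of \<open>f\<close>. Carrying \<open>j\<close> along makes the recursion on \<open>k\<close> primitive and
  avoids the binomial sums of the Leibniz rule.\<close>

fun shifted_deriv :: "real \<Rightarrow> (nat \<Rightarrow> real \<Rightarrow> real) \<Rightarrow> nat \<Rightarrow> nat \<Rightarrow> real \<Rightarrow> real" where
  "shifted_deriv a D 0 j x = D j x"
| "shifted_deriv a D (Suc k) j x = shifted_deriv a D k (Suc j) x - a * shifted_deriv a D k j x"

lemma shifted_deriv_has_derivative:
  assumes "deriv_chain S N D" "x \<in> S" "k + j < N"
  shows "(shifted_deriv a D k j has_vector_derivative shifted_deriv a D k (Suc j) x) (at x within S)"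
  using assms(3)
proof (induction k arbitrary: j)
  case 0
  have "shifted_deriv a D 0 j = D j" for j by (rule ext) simp
  thus ?case using assms 0 by (simp add: deriv_chain_def)
next
  case (Suc k)
  have e: "shifted_deriv a D (Suc k) j = (\<lambda>x. shifted_deriv a D k (Suc j) x - a * shifted_deriv a D k j x)"
    by (rule ext) simp
  show ?case unfolding e shifted_deriv.simps
    by (intro has_vector_derivative_diff has_vector_derivative_mult_right Suc.IH)
       (use Suc.prems in auto)
qed

lemma shifted_deriv_continuous:
  assumes "deriv_chain S N D" "k + j \<le> N"
  shows "continuous_on S (shifted_deriv a D k j)"
  using assms(2)
proof (induction k arbitrary: j)
  case 0
  have "shifted_deriv a D 0 j = D j" by (rule ext) simp
  thus ?case using deriv_chain_continuous[OF assms(1)] 0 by simp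
next
  case (Suc k)
  have e: "shifted_deriv a D (Suc k) j = (\<lambda>x. shifted_deriv a D k (Suc j) x - a * shifted_deriv a D k j x)"
    by (rule ext) simp
  show ?case unfolding e by (intro continuous_intros Suc.IH) (use Suc.prems in auto)
qed

lemma shifted_deriv_bound:
  assumes "a \<ge> 0" "\<And>k. k \<le> N \<Longrightarrow> \<bar>D k x\<bar> \<le> A" "k + j \<le> N"
  shows "\<bar>shifted_deriv a D k j x\<bar> \<le> (1 + a) ^ k * A"
  using assms(3)
proof (induction k arbitrary: j)
  case 0 thus ?case using assms by simp
next
  case (Suc k)
  have 1: "\<bar>shifted_deriv a D k (Suc j) x\<bar> \<le> (1 + a) ^ k * A"
    and 2: "\<bar>shifted_deriv a D k j x\<bar> \<le> (1 + a) ^ k * A"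
    using Suc by auto
  have "\<bar>a * shifted_deriv a D k j x\<bar> \<le> a * ((1 + a) ^ k * A)"
    using mult_left_mono[OF 2 assms(1)] assms(1) by (simp add: abs_mult)
  hence "\<bar>shifted_deriv a D (Suc k) j x\<bar> \<le> (1 + a) ^ k * A + a * ((1 + a) ^ k * A)"
    using 1 unfolding shifted_deriv.simps by linarith
  thus ?case by (simp add: algebra_simps)
qed

lemma deriv_chain_exp_mult:
  assumes "deriv_chain S N D"
  shows "deriv_chain S N (\<lambda>k x. exp (- a * (x - c)) * shifted_deriv a D k 0 x)"
  unfolding deriv_chain_def
proof (intro conjI allI impI ballI)
  fix k x assume k: "k < N" and x: "x \<in> S"
  have e: "((\<lambda>x. exp (- a * (x - c))) has_vector_derivative - a * exp (- a * (x - c))) (at x within S)"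
    unfolding has_real_derivative_iff_has_vector_derivative[symmetric]
    by (auto intro!: derivative_eq_intros)
  have s: "(shifted_deriv a D k 0 has_vector_derivative shifted_deriv a D k (Suc 0) x) (at x within S)"
    using shifted_deriv_has_derivative[OF assms x, of k 0] k by simp
  show "((\<lambda>x. exp (- a * (x - c)) * shifted_deriv a D k 0 x) has_vector_derivative
      exp (- a * (x - c)) * shifted_deriv a D (Suc k) 0 x) (at x within S)"
    using has_vector_derivative_mult[OF e s] by (simp add: algebra_simps)
next
  show "continuous_on S (\<lambda>x. exp (- a * (x - c)) * shifted_deriv a D N 0 x)"
    by (intro continuous_intros shifted_deriv_continuous[OF assms]) simp
qed

lemma deriv_chain_bounded:
  assumes "deriv_chain {a..b} N D"
  obtains A where "A \<ge> 0" "\<And>k x. k \<le> N \<Longrightarrow> x \<in> {a..b} \<Longrightarrow> \<bar>D k x\<bar> \<le> A"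
proof -
  have "bounded (\<Union>k\<in>{..N}. D k ` {a..b})"
    by (intro bounded_UN ballI compact_imp_bounded compact_continuous_image
        deriv_chain_continuous[OF assms]) auto
  then obtain A where "A > 0" "\<forall>y\<in>(\<Union>k\<in>{..N}. D k ` {a..b}). norm y \<le> A"
    by (meson bounded_pos)
  thus ?thesis using that[of A] by auto
qed


section \<open>Piecewise linear functions\<close>

lemma mesh_pos: "n \<ge> 1 \<Longrightarrow> mesh n > 0"
  by (simp add: mesh_def)

lemma node_0: "node n 0 = 0"
  by (simp add: node_def)

lemma node_last: "n \<ge> 1 \<Longrightarrow> node n n = 1"
  by (simp add: node_def mesh_def)

lemma node_prev: "i \<ge> 1 \<Longrightarrow> node n i = node n (i - 1) + mesh n"
  by (simp add: node_def of_nat_diff algebra_simps)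

lemma cell_subset: "i \<in> {1..n} \<Longrightarrow> {node n (i - 1)..node n i} \<subseteq> {0..1}"
proof -
  assume i: "i \<in> {1..n}"
  hence "node n i \<le> 1" by (simp add: node_def mesh_def)
  moreover have "0 \<le> node n (i - 1)" by (simp add: node_def mesh_def)
  ultimately show ?thesis by auto
qed

lemma hat_on_cell:
  assumes "i \<in> {1..n}" "x \<in> {node n (i - 1)..node n i}"
  shows "hat n j x = (if j = i then (x - node n (i - 1)) / mesh n
           else if j = i - 1 then 1 - (x - node n (i - 1)) / mesh n else 0)"
proof -
  have n: "n > 0" using assms by simp
  have h: "hat n j x = max 0 (1 - \<bar>real n * x - real j\<bar>)"
  proof -
    have "x - node n j = (real n * x - real j) / real n"
      using n by (simp add: node_def mesh_def field_simps)
    thus ?thesis using n by (simp add: hat_def mesh_def abs_divide)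
  qed
  have t: "(x - node n (i - 1)) / mesh n = real n * x - (real i - 1)"
    using assms n by (auto simp: node_def mesh_def of_nat_diff field_simps)
  have c: "real i - 1 \<le> real n * x" "real n * x \<le> real i"
    using assms n by (auto simp: node_def mesh_def field_simps of_nat_diff)
  consider "j = i" | "j = i - 1" | "j \<ge> i + 1" | "j + 2 \<le> i" by linarith
  thus ?thesis
  proof cases
    case 2
    hence "j \<noteq> i" "real j = real i - 1" using assms by (auto simp: of_nat_diff)
    thus ?thesis using h t c 2 by (simp add: max_def)
  next
    case 3
    hence "j \<noteq> i" "j \<noteq> i - 1" "real j \<ge> real i + 1" by auto
    thus ?thesis using h c by (simp add: max_def)
  next
    case 4
    hence "j \<noteq> i" "j \<noteq> i - 1" "real j + 2 \<le> real i" by auto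
    thus ?thesis using h c by (simp add: max_def)
  qed (use h t c in \<open>simp add: max_def\<close>)
qed

lemma sum_interior:
  fixes F :: "nat \<Rightarrow> 'a::comm_monoid_add"
  assumes "F 0 = 0" "F n = 0"
  shows "(\<Sum>j=1..n-1. F j) = (\<Sum>j=0..n. F j)"
proof (rule sum.mono_neutral_left)
  show "\<forall>i\<in>{0..n} - {1..n - 1}. F i = 0"
  proof
    fix i assume "i \<in> {0..n} - {1..n - 1}"
    hence "i = 0 \<or> i = n" by auto
    thus "F i = 0" using assms by auto
  qed
qed auto

lemma lin_comb_on_cell:
  assumes "i \<in> {1..n}" "x \<in> {node n (i - 1)..node n i}" "c 0 = 0" "c n = 0"
  shows "lin_comb n c x = c (i - 1) + (c i - c (i - 1)) * ((x - node n (i - 1)) / mesh n)"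
proof -
  have ne: "i - 1 \<noteq> i" using assms(1) by auto
  have "lin_comb n c x = (\<Sum>j=0..n. c j * hat n j x)"
    unfolding lin_comb_def by (rule sum_interior) (use assms in auto)
  also have "\<dots> = (\<Sum>j\<in>{i - 1, i}. c j * hat n j x)"
    by (rule sum.mono_neutral_right) (use assms in \<open>auto simp: hat_on_cell[OF assms(1,2)]\<close>)
  also have "\<dots> = c (i - 1) * (1 - (x - node n (i - 1)) / mesh n) + c i * ((x - node n (i - 1)) / mesh n)"
    using ne by (simp add: hat_on_cell[OF assms(1,2)])
  finally show ?thesis by (simp only: left_diff_distrib right_diff_distrib mult_1_right)
qed

lemma deriv_lin_comb_on_cell:
  assumes "i \<in> {1..n}" "x \<in> {node n (i - 1)<..<node n i}" "c 0 = 0" "c n = 0"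
  shows "deriv (lin_comb n c) x = (c i - c (i - 1)) / mesh n"
proof (rule DERIV_imp_deriv)
  have "((\<lambda>x. c (i - 1) + (c i - c (i - 1)) * ((x - node n (i - 1)) / mesh n))
      has_real_derivative (c i - c (i - 1)) / mesh n) (at x)"
    using mesh_pos[of n] assms(1) by (auto intro!: derivative_eq_intros)
  thus "(lin_comb n c has_real_derivative (c i - c (i - 1)) / mesh n) (at x)"
    by (rule has_field_derivative_transform_within_open[of _ _ _ "{node n (i - 1)<..<node n i}"])
       (use assms lin_comb_on_cell[OF assms(1) _ assms(3,4)] in auto)
qed

lemma lin_comb_zero_extension:
  "lin_comb n c = lin_comb n (\<lambda>j. if j \<in> {1..n - 1} then c j else 0)"
  unfolding lin_comb_def by (rule ext, rule sum.cong) auto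

lemma has_integral_mesh:
  fixes F :: "real \<Rightarrow> real"
  assumes "n \<ge> 1" "\<And>i. i \<in> {1..n} \<Longrightarrow> (F has_integral I i) {node n (i - 1)..node n i}"
  shows "(F has_integral (\<Sum>i=1..n. I i)) {0..1}"
proof -
  have "(F has_integral (\<Sum>i=1..k. I i)) {0..node n k}" if "k \<le> n" for k
    using that
  proof (induction k)
    case 0
    show ?case using has_integral_refl(2)[of F 0] by (simp add: node_0)
  next
    case (Suc k)
    have le: "0 \<le> node n k" "node n k \<le> node n (Suc k)"
      by (auto simp: node_def mesh_def divide_right_mono)
    have "(F has_integral I (Suc k)) {node n k..node n (Suc k)}"
      using assms(2)[of "Suc k"] Suc.prems by simp
    from has_integral_combine[OF le Suc.IH this] Suc.prems show ?case by simp
  qed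
  from this[of n] show ?thesis using node_last[OF assms(1)] by simp
qed

lemma integral_deriv_lin_comb_mult:
  assumes "n \<ge> 1" "v 0 = 0" "v n = 0" "w 0 = 0" "w n = 0"
  shows "integral {0..1} (\<lambda>x. deriv (lin_comb n v) x * deriv (lin_comb n w) x) =
           (\<Sum>i=1..n. (v i - v (i - 1)) * (w i - w (i - 1)) / mesh n)"
proof (intro integral_unique has_integral_mesh assms(1))
  fix i assume i: "i \<in> {1..n}"
  have h: "mesh n > 0" using mesh_pos assms(1) by simp
  have nd: "node n i = node n (i - 1) + mesh n" using node_prev[of i n] i by simp
  define s where "s = (v i - v (i - 1)) / mesh n * ((w i - w (i - 1)) / mesh n)"
  have "((\<lambda>x. deriv (lin_comb n v) x * deriv (lin_comb n w) x) has_integral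
      s * node n i - s * node n (i - 1)) {node n (i - 1)..node n i}"
  proof (rule fundamental_theorem_of_calculus_interior)
    fix x assume "x \<in> {node n (i - 1)<..<node n i}"
    hence "deriv (lin_comb n v) x * deriv (lin_comb n w) x = s"
      by (simp add: s_def deriv_lin_comb_on_cell[OF i] assms)
    thus "((\<lambda>x. s * x) has_vector_derivative
        deriv (lin_comb n v) x * deriv (lin_comb n w) x) (at x)"
      by (auto simp flip: has_real_derivative_iff_has_vector_derivative
          intro!: derivative_eq_intros)
  qed (use nd h in \<open>auto intro!: continuous_intros\<close>)
  moreover have "s * node n i - s * node n (i - 1) = s * mesh n"
    by (simp add: nd algebra_simps)
  moreover have "s * mesh n = (v i - v (i - 1)) * (w i - w (i - 1)) / mesh n"
    using h by (simp add: s_def)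
  ultimately show "((\<lambda>x. deriv (lin_comb n v) x * deriv (lin_comb n w) x) has_integral
      (v i - v (i - 1)) * (w i - w (i - 1)) / mesh n) {node n (i - 1)..node n i}"
    by simp
qed

lemma integral_deriv_lin_comb_mult_lin_comb:
  assumes "n \<ge> 1" "v 0 = 0" "v n = 0" "w 0 = 0" "w n = 0"
  shows "integral {0..1} (\<lambda>x. deriv (lin_comb n v) x * lin_comb n w x) =
           (\<Sum>i=1..n. (v i - v (i - 1)) * (w i + w (i - 1)) / 2)"
proof (intro integral_unique has_integral_mesh assms(1))
  fix i assume i: "i \<in> {1..n}"
  have h: "mesh n > 0" using mesh_pos assms(1) by simp
  define p where "p = node n (i - 1)"
  have nd: "node n i = p + mesh n" using node_prev[of i n] i by (simp add: p_def)
  define s where "s = (v i - v (i - 1)) / mesh n"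
  define t where "t = (w i - w (i - 1)) / mesh n"
  define H where "H = (\<lambda>x. s * (w (i - 1) * (x - p) + t * (x - p)\<^sup>2 / 2))"
  have "((\<lambda>x. deriv (lin_comb n v) x * lin_comb n w x) has_integral
      H (p + mesh n) - H p) {p..p + mesh n}"
  proof (rule fundamental_theorem_of_calculus_interior)
    show "continuous_on {p..p + mesh n} H"
      unfolding H_def by (intro continuous_intros) auto
    fix x assume x: "x \<in> {p<..<p + mesh n}"
    have "deriv (lin_comb n v) x = s" "lin_comb n w x = w (i - 1) + t * (x - p)"
      using x deriv_lin_comb_on_cell[OF i, of x v] lin_comb_on_cell[OF i, of x w] assms h nd
      by (auto simp: s_def t_def p_def)
    moreover have "(H has_real_derivative s * (w (i - 1) + t * (x - p))) (at x)"
      unfolding H_def by (rule derivative_eq_intros refl | simp)+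
    ultimately show "(H has_vector_derivative deriv (lin_comb n v) x * lin_comb n w x) (at x)"
      by (simp add: has_real_derivative_iff_has_vector_derivative)
  qed (use h in auto)
  moreover have "H (p + mesh n) - H p = (v i - v (i - 1)) * (w i + w (i - 1)) / 2"
    using h unfolding H_def s_def t_def by (simp add: field_simps power2_eq_square)
  ultimately show "((\<lambda>x. deriv (lin_comb n v) x * lin_comb n w x) has_integral
      (v i - v (i - 1)) * (w i + w (i - 1)) / 2) {node n (i - 1)..node n i}"
    by (simp only: nd p_def[symmetric])
qed

text \<open>Cauchy-Schwarz: \<open>|w|\<^sup>2 = n \<Sum> (w\<^sub>i - w\<^bsub>i-1\<^esub>)\<^sup>2\<close>, and the sum on the left has \<open>n\<close> terms.\<close>

lemma nodal_variation_le_h1_seminorm: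
  assumes "n \<ge> 1" "w 0 = 0" "w n = 0"
  shows "(\<Sum>i=1..n. \<bar>w i - w (i - 1)\<bar>) \<le> h1_seminorm (lin_comb n w)"
proof -
  have "integral {0..1} (\<lambda>x. (deriv (lin_comb n w) x)\<^sup>2) = real n * (\<Sum>i=1..n. (w i - w (i - 1))\<^sup>2)"
    using integral_deriv_lin_comb_mult[of n w w] assms
    by (simp add: power2_eq_square mesh_def sum_distrib_left mult.commute)
  moreover have "(\<Sum>i=1..n. \<bar>w i - w (i - 1)\<bar>)\<^sup>2 \<le> real n * (\<Sum>i=1..n. (w i - w (i - 1))\<^sup>2)"
    using sum_squared_le_sum_of_squares[of "\<lambda>i. \<bar>w i - w (i - 1)\<bar>" "{1..n}"] by (simp add: mult.commute)
  ultimately show ?thesis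
    unfolding h1_seminorm_def by (intro real_le_rsqrt) simp
qed

lemma nodal_value_le_variation:
  fixes w :: "nat \<Rightarrow> real"
  assumes "w 0 = 0" "k \<le> n"
  shows "\<bar>w k\<bar> \<le> (\<Sum>i=1..n. \<bar>w i - w (i - 1)\<bar>)"
proof -
  have "\<bar>w k\<bar> \<le> (\<Sum>i=1..k. \<bar>w i - w (i - 1)\<bar>)"
    using assms(1) by (induction k) auto
  also have "\<dots> \<le> (\<Sum>i=1..n. \<bar>w i - w (i - 1)\<bar>)"
    by (rule sum_mono2) (use assms in auto)
  finally show ?thesis .
qed

text \<open>Converts between sums over interior nodes and sums over cells. The sequences \<open>a\<close> and \<open>b\<close> are
  kept separate because \<open>a = b\<close> is needed for the discrete flux, whereas the quadrature errors
  on the two sides of a node come from different functions.\<close>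

lemma summation_by_parts:
  fixes w a b :: "nat \<Rightarrow> real"
  assumes "n \<ge> 1" "w 0 = 0" "w n = 0"
  shows "(\<Sum>j=1..n-1. w j * (a j - b (j + 1))) = (\<Sum>i=1..n. w i * a i - w (i - 1) * b i)"
proof -
  obtain k where k: "n = Suc k" using assms(1) by (cases n) auto
  have "(\<Sum>i=1..n. w (i - 1) * b i) = (\<Sum>j=0..k. w j * b (j + 1))"
    unfolding k using sum.shift_bounds_cl_Suc_ivl[of "\<lambda>i. w (i - 1) * b i" 0 k] by simp
  also have "\<dots> = (\<Sum>j=1..k. w j * b (j + 1))"
    using assms(2) by (simp add: sum.atLeast_Suc_atMost)
  finally have 1: "(\<Sum>i=1..n. w (i - 1) * b i) = (\<Sum>j=1..k. w j * b (j + 1))" .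
  have 2: "(\<Sum>i=1..n. w i * a i) = (\<Sum>j=1..k. w j * a j)"
    using assms(3) k by simp
  show ?thesis using 1 2 k by (simp add: sum_subtractf algebra_simps)
qed


section \<open>The upwind flux\<close>

text \<open>The factor that makes \<open>1 - exp (- x / \<epsilon>)\<close> equal to 1 at \<open>x = h\<close>.\<close>

definition bubble_const :: "real \<Rightarrow> real \<Rightarrow> real" where
  "bubble_const \<epsilon> h = 1 / (1 - exp (- h / \<epsilon>))"

text \<open>The discrete counterpart of \<open>\<epsilon> v' - v\<close>.\<close>

definition upwind_flux :: "real \<Rightarrow> nat \<Rightarrow> (nat \<Rightarrow> real) \<Rightarrow> nat \<Rightarrow> real" where
  "upwind_flux \<epsilon> n v i = bubble_const \<epsilon> (mesh n) * (v i - v (i - 1)) - v i"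

text \<open>In terms of \<open>t = h / \<epsilon>\<close> this is \<open>coth (t / 2) = 2 / (1 - exp (- t)) - 1\<close>. It turns the three
  matrix entries into \<open>2 K - 1\<close>, \<open>- K\<close> and \<open>1 - K\<close>.\<close>

lemma inverse_g0:
  assumes "\<epsilon> > 0" "n \<ge> 1"
  shows "g0 \<epsilon> n > 0" "1 / g0 \<epsilon> n = 2 * bubble_const \<epsilon> (mesh n) - 1"
proof -
  define t where "t = mesh n / \<epsilon>"
  have t: "t > 0" using assms mesh_pos by (simp add: t_def)
  have g: "g0 \<epsilon> n = (1 - exp (- t)) / (1 + exp (- t))"
    using tanh_real_altdef[of "t / 2"] by (simp add: g0_def t_def mult.commute)
  have e: "exp (- t) < 1" "exp (- t) > 0" using t by auto
  show "g0 \<epsilon> n > 0" unfolding g using e by (intro divide_pos_pos add_pos_pos) auto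
  show "1 / g0 \<epsilon> n = 2 * bubble_const \<epsilon> (mesh n) - 1"
    unfolding g bubble_const_def using e by (simp add: t_def[symmetric] field_simps)
qed

lemma bubble_const_bound:
  assumes "\<epsilon> > 0" "0 < h" "h \<le> 1"
  shows "bubble_const \<epsilon> h \<ge> 0" "bubble_const \<epsilon> h \<le> (1 + \<epsilon>) / h"
proof -
  define t where "t = h / \<epsilon>"
  have t: "t > 0" using assms by (simp add: t_def)
  have e: "exp (- t) < 1" using t by auto
  show "bubble_const \<epsilon> h \<ge> 0" unfolding bubble_const_def using e by (simp add: t_def)
  \<comment> \<open>\<open>exp t \<ge> 1 + t\<close> gives \<open>1 - exp (- t) \<ge> t / (1 + t)\<close>, hence \<open>K \<le> (1 + t) / t = (h + \<epsilon>) / h\<close>.\<close>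
  have "exp (- t) = 1 / exp t" by (simp add: exp_minus field_simps)
  also have "\<dots> \<le> 1 / (1 + t)"
    using exp_ge_add_one_self[of t] t by (intro divide_left_mono) auto
  finally have "t / (1 + t) \<le> 1 - exp (- t)" using t by (simp add: field_simps)
  hence "1 / (1 - exp (- t)) \<le> 1 / (t / (1 + t))"
    using t by (intro divide_left_mono) (use e in auto)
  also have "\<dots> = (h + \<epsilon>) / h" using assms by (simp add: t_def field_simps)
  also have "\<dots> \<le> (1 + \<epsilon>) / h" using assms by (intro divide_right_mono) auto
  finally show "bubble_const \<epsilon> h \<le> (1 + \<epsilon>) / h" by (simp add: bubble_const_def t_def)
qed

lemma fd_matrix_row:
  assumes "\<epsilon> > 0" "j \<in> {1..n-1}" "v 0 = 0" "v n = 0"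
  shows "(\<Sum>k=1..n-1. fd_matrix \<epsilon> n j k * v k) = upwind_flux \<epsilon> n v j - upwind_flux \<epsilon> n v (j + 1)"
proof -
  define K where "K = bubble_const \<epsilon> (mesh n)"
  have n: "n \<ge> 1" using assms(2) by auto
  have g: "g0 \<epsilon> n > 0" "1 / g0 \<epsilon> n = 2 * K - 1"
    using inverse_g0[OF assms(1) n] by (auto simp: K_def)
  have c: "- (1 + g0 \<epsilon> n) / (2 * g0 \<epsilon> n) = - K" "- (1 - g0 \<epsilon> n) / (2 * g0 \<epsilon> n) = 1 - K"
    using g by (auto simp: field_simps)
  have ne: "j - 1 \<noteq> j" "j - 1 \<noteq> j + 1" "j = j - 1 + 1" using assms(2) by auto
  have "(\<Sum>k=1..n-1. fd_matrix \<epsilon> n j k * v k) = (\<Sum>k=0..n. fd_matrix \<epsilon> n j k * v k)"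
    by (rule sum_interior) (use assms in auto)
  also have "\<dots> = (\<Sum>k\<in>{j - 1, j, j + 1}. fd_matrix \<epsilon> n j k * v k)"
    by (rule sum.mono_neutral_right) (use assms in \<open>auto simp: fd_matrix_def\<close>)
  also have "\<dots> = - K * v (j - 1) + (2 * K - 1) * v j + (1 - K) * v (j + 1)"
    using ne g(2) c by (simp add: fd_matrix_def)
  finally show ?thesis by (simp add: upwind_flux_def K_def algebra_simps)
qed

text \<open>The diffusion coefficient \<open>h / (2 g\<^sub>0)\<close> contributes \<open>(K - 1/2) (v\<^sub>i - v\<^bsub>i-1\<^esub>)\<close> per cell. In the
  convection term the midpoint value of \<open>w\<close> is moved onto \<open>v\<close> by discrete partial integration, which
  leaves \<open>- (v\<^sub>i + v\<^bsub>i-1\<^esub>) / 2 = - v\<^sub>i + (v\<^sub>i - v\<^bsub>i-1\<^esub>) / 2\<close> and a telescoping sum.\<close>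

lemma upwind_form_lin_comb:
  assumes "\<epsilon> > 0" "n \<ge> 1" "v 0 = 0" "v n = 0" "w 0 = 0" "w n = 0"
  shows "upwind_form \<epsilon> n (lin_comb n v) (lin_comb n w) =
           (\<Sum>i=1..n. (w i - w (i - 1)) * upwind_flux \<epsilon> n v i)"
proof -
  define K where "K = bubble_const \<epsilon> (mesh n)"
  have h: "mesh n > 0" using mesh_pos assms by simp
  have g: "1 / g0 \<epsilon> n = 2 * K - 1" using inverse_g0[OF assms(1,2)] by (simp add: K_def)
  have "upwind_form \<epsilon> n (lin_comb n v) (lin_comb n w) =
      1 / g0 \<epsilon> n * (mesh n / 2) * (\<Sum>i=1..n. (v i - v (i - 1)) * (w i - w (i - 1)) / mesh n)
      + (\<Sum>i=1..n. (v i - v (i - 1)) * (w i + w (i - 1)) / 2)"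
    unfolding upwind_form_def using assms
    by (simp add: integral_deriv_lin_comb_mult integral_deriv_lin_comb_mult_lin_comb)
  also have "\<dots> = (\<Sum>i=1..n. (w i - w (i - 1)) * upwind_flux \<epsilon> n v i + (v i * w i - v (i - 1) * w (i - 1)))"
    unfolding g sum_distrib_left sum.distrib[symmetric]
    by (rule sum.cong) (use h in \<open>auto simp: upwind_flux_def K_def[symmetric] field_simps\<close>)
  also have "\<dots> = (\<Sum>i=1..n. (w i - w (i - 1)) * upwind_flux \<epsilon> n v i)
      + (\<Sum>i=1..n. v i * w i - v (i - 1) * w (i - 1))"
    by (simp add: sum.distrib)
  also have "(\<Sum>i=1..n. v i * w i - v (i - 1) * w (i - 1)) = 0"
    using sum_telescope''[of 0 n "\<lambda>i. v i * w i"] assms by simp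
  finally show ?thesis by simp
qed


section \<open>The test functions\<close>

text \<open>The increasing one of the two test functions that live on cell \<open>i\<close>, as one smooth
  formula on the whole line. The other one is \<open>1 - cell_test\<close>.\<close>

definition cell_test :: "real \<Rightarrow> nat \<Rightarrow> nat \<Rightarrow> real \<Rightarrow> real" where
  "cell_test \<epsilon> n i x = bubble_const \<epsilon> (mesh n) * (1 - exp (- (x - node n (i - 1)) / \<epsilon>))"

lemma exp_bubble_formula:
  assumes "\<epsilon> > 0" "h > 0" "x \<in> {0..h}"
  shows "exp_bubble \<epsilon> h x = bubble_const \<epsilon> h * (1 - exp (- x / \<epsilon>)) - x / h"
proof -
  define K where "K = bubble_const \<epsilon> h"
  define b where "b = (\<lambda>x. K * (1 - exp (- x / \<epsilon>)) - x / h)"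
  define b' where "b' = (\<lambda>x. K * exp (- x / \<epsilon>) / \<epsilon> - 1 / h)"
  define b'' where "b'' = (\<lambda>x. - K * exp (- x / \<epsilon>) / \<epsilon>\<^sup>2)"
  define B where "B = (\<lambda>x. if x \<in> {0..h} then b x else 0)"
  have K: "K * (1 - exp (- h / \<epsilon>)) = 1" using assms by (simp add: K_def bubble_const_def)
  have db: "(b has_real_derivative b' x) (at x)" for x
    unfolding b_def b'_def using assms by (auto intro!: derivative_eq_intros simp: field_simps)
  have db': "(b' has_real_derivative b'' x) (at x)" for x
    unfolding b'_def b''_def using assms
    by (auto intro!: derivative_eq_intros simp: field_simps power2_eq_square)
  have dB: "(B has_real_derivative b' x) (at x)" if "x \<in> {0<..<h}" for x
    by (rule has_field_derivative_transform_within_open[OF db, of "{0<..<h}"])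
       (use that in \<open>auto simp: B_def\<close>)
  have dB': "(deriv B has_real_derivative b'' x) (at x)" if "x \<in> {0<..<h}" for x
    by (rule has_field_derivative_transform_within_open[OF db', of "{0<..<h}"])
       (use that in \<open>auto simp: DERIV_imp_deriv[OF dB]\<close>)
  have "dirichlet_solution \<epsilon> (-1) (\<lambda>_. 1 / h) h B"
    unfolding dirichlet_solution_def
  proof (intro conjI ballI)
    have "continuous_on {0..h} b"
      using db by (meson DERIV_continuous continuous_at_imp_continuous_on)
    thus "continuous_on {0..h} B" by (rule continuous_on_eq) (simp add: B_def)
    show "B 0 = 0" "B h = 0" using assms K by (auto simp: B_def b_def)
    fix x assume x: "x \<in> {0<..<h}"
    show "B differentiable (at x)" "deriv B differentiable (at x)"
      using dB[OF x] dB'[OF x] unfolding real_differentiable_def by blast+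
    have "- \<epsilon> * b'' x + (-1) * b' x = 1 / h"
      unfolding b'_def b''_def using assms by (simp add: power2_eq_square)
    thus "- \<epsilon> * deriv (deriv B) x + - 1 * deriv B x = 1 / h"
      using dB[OF x] dB'[OF x] by (simp add: DERIV_imp_deriv)
  qed
  hence "exp_bubble \<epsilon> h = B"
    unfolding exp_bubble_def
    by (intro the1_equality exp_bubble_ex1 assms conjI) (auto simp: B_def)
  thus ?thesis using assms(3) by (simp add: B_def b_def K_def)
qed

text \<open>The neighbouring bubbles meet the closed cell only at an endpoint, where they vanish. So the
  formulas hold on the closed cell, as quadrature rules with endpoint nodes require.\<close>

lemma test_fun_on_cell:
  assumes "\<epsilon> > 0" "i \<in> {1..n}" "x \<in> {node n (i - 1)..node n i}"
  shows "test_fun \<epsilon> n i x = cell_test \<epsilon> n i x"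
    and "i \<ge> 2 \<Longrightarrow> test_fun \<epsilon> n (i - 1) x = 1 - cell_test \<epsilon> n i x"
proof -
  have h: "mesh n > 0" using assms mesh_pos by simp
  have nd: "node n i = node n (i - 1) + mesh n" using node_prev[of i n] assms by simp
  have B0: "exp_bubble \<epsilon> (mesh n) 0 = 0" "exp_bubble \<epsilon> (mesh n) (mesh n) = 0"
    using h assms(1) by (auto simp: exp_bubble_formula bubble_const_def)
  have b: "cell_bubble \<epsilon> n i x = cell_test \<epsilon> n i x - (x - node n (i - 1)) / mesh n"
    using assms nd h exp_bubble_formula[of \<epsilon> "mesh n" "x - node n (i - 1)"]
    by (simp add: cell_bubble_def cell_test_def)
  have 1: "cell_bubble \<epsilon> n (i + 1) x = 0"
    using assms(3) B0 by (auto simp: cell_bubble_def)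
  show "test_fun \<epsilon> n i x = cell_test \<epsilon> n i x"
    using b 1 hat_on_cell[OF assms(2,3)] by (simp add: test_fun_def)
  show "test_fun \<epsilon> n (i - 1) x = 1 - cell_test \<epsilon> n i x" if "i \<ge> 2"
  proof -
    have "node n (i - 1) = node n (i - 1 - 1) + mesh n" using node_prev[of "i - 1" n] that by simp
    hence "node n (i - 1) - node n (i - 1 - 1) = mesh n" by simp
    hence "cell_bubble \<epsilon> n (i - 1) x = 0"
      using assms(3) B0 unfolding cell_bubble_def
      by (cases "x = node n (i - 1)") auto
    moreover have "i - 1 + 1 = i" "i - 1 \<noteq> i" using that by auto
    ultimately show ?thesis
      using b hat_on_cell[OF assms(2,3), of "i - 1"] by (simp add: test_fun_def)
  qed
qed


section \<open>Exactness of the scheme with exact integrals\<close>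

text \<open>A classical solution is differentiable only in the open interval, so \<open>- \<epsilon> u' + u\<close> has no meaning
  at the endpoints. It differs from \<open>\<integral>\<^sub>0\<^sup>x f\<close> by a constant inside the interval; the latter supplies
  the continuous extension \<open>z\<close>.\<close>

lemma flux_of_solution:
  assumes "\<epsilon> > 0" "dirichlet_solution \<epsilon> 1 f 1 u" "continuous_on {0..1} f"
  obtains z where "continuous_on {0..1} z"
    "\<And>x. x \<in> {0<..<1} \<Longrightarrow> (z has_real_derivative f x) (at x)"
    "\<And>x. x \<in> {0<..<1} \<Longrightarrow> (u has_real_derivative (u x - z x) / \<epsilon>) (at x)"
proof -
  define P where "P = (\<lambda>x. integral {0..x} f)"
  have Pw: "(P has_vector_derivative f x) (at x within {0..1})" if "x \<in> {0..1}" for x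
    unfolding P_def by (rule integral_has_vector_derivative[OF assms(3) that])
  have contP: "continuous_on {0..1} P"
    using Pw by (meson continuous_on_eq_continuous_within has_vector_derivative_continuous)
  have dP: "(P has_real_derivative f x) (at x)" if "x \<in> {0<..<1}" for x
  proof -
    have "at x within {0..1} = at x"
      by (rule at_within_interior) (use that in auto)
    thus ?thesis using Pw[of x] that by (simp add: has_real_derivative_iff_has_vector_derivative)
  qed
  have du: "(u has_real_derivative deriv u x) (at x)"
    and ddu: "(deriv u has_real_derivative deriv (deriv u) x) (at x)"
    and ode: "- \<epsilon> * deriv (deriv u) x + deriv u x = f x" if "x \<in> {0<..<1}" for x
    using assms(2) that by (auto simp: dirichlet_solution_def DERIV_deriv_iff_real_differentiable)
  define r where "r = (\<lambda>x. - \<epsilon> * deriv u x + u x - P x)"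
  have dr: "(r has_real_derivative 0) (at x)" if x: "x \<in> {0<..<1}" for x
  proof -
    have "(r has_real_derivative - \<epsilon> * deriv (deriv u) x + deriv u x - f x) (at x)"
      unfolding r_def using du[OF x] ddu[OF x] dP[OF x] by (auto intro!: derivative_eq_intros)
    thus ?thesis using ode[OF x] by simp
  qed
  define c where "c = r (1 / 2)"
  have rc: "r x = c" if "x \<in> {0<..<1}" for x
    unfolding c_def by (rule DERIV_isconst3[of 0 1]) (use that dr in auto)
  show ?thesis
  proof (rule that[of "\<lambda>x. P x + c"])
    show "continuous_on {0..1} (\<lambda>x. P x + c)" using contP by (intro continuous_intros)
    fix x :: real assume x: "x \<in> {0<..<1}"
    show "((\<lambda>x. P x + c) has_real_derivative f x) (at x)"
      using dP[OF x] by (auto intro!: derivative_eq_intros)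
    have "\<epsilon> * deriv u x = u x - (P x + c)" using rc[OF x] by (simp add: r_def)
    hence "deriv u x = (u x - (P x + c)) / \<epsilon>" using assms(1) by (simp add: field_simps)
    thus "(u has_real_derivative (u x - (P x + c)) / \<epsilon>) (at x)" using du[OF x] by simp
  qed
qed

text \<open>\<open>(z - u) \<phi> + K u\<close> is an antiderivative of \<open>f \<phi>\<close>: its derivative is
  \<open>f \<phi> + u' (K - \<phi>) + (z - u) \<phi>'\<close>, and the last two terms cancel because \<open>\<epsilon> \<phi>' = K - \<phi>\<close> and
  \<open>\<epsilon> u' = u - z\<close>. The endpoint values of \<open>\<phi>\<close> are 0 and 1.\<close>

lemma integral_on_cell:
  assumes "\<epsilon> > 0" "i \<in> {1..n}" "continuous_on {0..1} u" "continuous_on {0..1} z"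
    and dz: "\<And>x. x \<in> {0<..<1} \<Longrightarrow> (z has_real_derivative f x) (at x)"
    and du: "\<And>x. x \<in> {0<..<1} \<Longrightarrow> (u has_real_derivative (u x - z x) / \<epsilon>) (at x)"
  shows "integral {node n (i - 1)..node n i} f = z (node n i) - z (node n (i - 1))"
    and "integral {node n (i - 1)..node n i} (\<lambda>x. f x * cell_test \<epsilon> n i x) =
           z (node n i) + upwind_flux \<epsilon> n (\<lambda>j. u (node n j)) i"
proof -
  define p where "p = node n (i - 1)"
  define K where "K = bubble_const \<epsilon> (mesh n)"
  define \<phi> where "\<phi> = cell_test \<epsilon> n i"
  have h: "mesh n > 0" using assms mesh_pos by simp
  have nd: "node n i = p + mesh n" using node_prev[of i n] assms by (simp add: p_def)
  have le: "p \<le> node n i" using nd h by simp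
  have sub: "{p..node n i} \<subseteq> {0..1}" using cell_subset[OF assms(2)] by (simp add: p_def)
  have sub': "x \<in> {0<..<1}" if "x \<in> {p<..<node n i}" for x
    using sub that le by auto
  have dphi: "(\<phi> has_real_derivative (K - \<phi> x) / \<epsilon>) (at x)" for x
    unfolding \<phi>_def cell_test_def K_def[symmetric] using assms(1)
    by (auto intro!: derivative_eq_intros simp: field_simps)
  have contphi: "continuous_on {p..node n i} \<phi>"
    using dphi by (meson DERIV_continuous continuous_at_imp_continuous_on)
  have cont: "continuous_on {p..node n i} u" "continuous_on {p..node n i} z"
    using assms(3,4) sub by (auto intro: continuous_on_subset)
  have "(f has_integral z (node n i) - z p) {p..node n i}"
    by (rule fundamental_theorem_of_calculus_interior[OF le cont(2)])
       (use dz sub' in \<open>auto simp flip: has_real_derivative_iff_has_vector_derivative\<close>)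
  thus "integral {node n (i - 1)..node n i} f = z (node n i) - z (node n (i - 1))"
    unfolding p_def by (rule integral_unique)
  define H where "H = (\<lambda>x. (z x - u x) * \<phi> x + K * u x)"
  have "((\<lambda>x. f x * \<phi> x) has_integral H (node n i) - H p) {p..node n i}"
  proof (rule fundamental_theorem_of_calculus_interior[OF le])
    show "continuous_on {p..node n i} H"
      unfolding H_def by (intro continuous_intros cont contphi)
    fix x assume "x \<in> {p<..<node n i}"
    hence x: "x \<in> {0<..<1}" by (rule sub')
    have "(H has_real_derivative (f x - (u x - z x) / \<epsilon>) * \<phi> x + (z x - u x) * ((K - \<phi> x) / \<epsilon>)
        + K * ((u x - z x) / \<epsilon>)) (at x)"
      unfolding H_def
      by (rule DERIV_cong[OF DERIV_add[OF DERIV_mult[OF DERIV_diff[OF dz[OF x] du[OF x]] dphi]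
              DERIV_cmult[OF du[OF x]]]]) (simp add: algebra_simps)
    also have "(f x - (u x - z x) / \<epsilon>) * \<phi> x + (z x - u x) * ((K - \<phi> x) / \<epsilon>)
        + K * ((u x - z x) / \<epsilon>) = f x * \<phi> x"
      using assms(1) by (simp add: field_simps)
    finally show "(H has_vector_derivative f x * \<phi> x) (at x)"
      by (simp add: has_real_derivative_iff_has_vector_derivative)
  qed
  hence "integral {p..node n i} (\<lambda>x. f x * \<phi> x) = H (node n i) - H p"
    by (rule integral_unique)
  also have "\<dots> = z (node n i) + (K * (u (node n i) - u p) - u (node n i))"
  proof -
    have "\<phi> p = 0" "\<phi> (node n i) = 1"
      using h assms(1) nd by (auto simp: \<phi>_def cell_test_def p_def bubble_const_def)
    thus ?thesis unfolding H_def by (simp add: right_diff_distrib)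
  qed
  finally have "integral {p..node n i} (\<lambda>x. f x * \<phi> x) =
      z (node n i) + (K * (u (node n i) - u p) - u (node n i))" .
  thus "integral {node n (i - 1)..node n i} (\<lambda>x. f x * cell_test \<epsilon> n i x) =
           z (node n i) + upwind_flux \<epsilon> n (\<lambda>j. u (node n j)) i"
    by (simp add: p_def \<phi>_def K_def upwind_flux_def)
qed


section \<open>Quadrature errors\<close>

definition quad_error :: "(real \<times> real) list \<Rightarrow> nat \<Rightarrow> nat \<Rightarrow> (real \<Rightarrow> real) \<Rightarrow> real" where
  "quad_error q n i F = integral {node n (i - 1)..node n i} F - quad q n i F"

lemma quad_diff: "quad q n i (\<lambda>x. F x - G x) = quad q n i F - quad q n i G"
  unfolding quad_def by (induction q) (auto simp: algebra_simps)

lemma quad_cmult: "quad q n i (\<lambda>x. c * F x) = c * quad q n i F"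
  unfolding quad_def by (induction q) (auto simp: algebra_simps)

lemma quad_cong:
  assumes "quadrature_rule q" "i \<in> {1..n}"
    and "\<And>x. x \<in> {node n (i - 1)..node n i} \<Longrightarrow> F x = G x"
  shows "quad q n i F = quad q n i G"
proof -
  have h: "mesh n > 0" using assms mesh_pos by simp
  have nd: "node n i = node n (i - 1) + mesh n" using node_prev[of i n] assms by simp
  have "F (node n (i - 1) + mesh n * \<xi>) = G (node n (i - 1) + mesh n * \<xi>)"
    if "(\<xi>, w) \<in> set q" for \<xi> w
  proof (rule assms(3))
    have "0 \<le> \<xi>" "\<xi> \<le> 1" using assms(1) that by (auto simp: quadrature_rule_def)
    thus "node n (i - 1) + mesh n * \<xi> \<in> {node n (i - 1)..node n i}"
      using h nd by (auto simp: mult_left_le)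
  qed
  hence "map (\<lambda>(\<xi>, w). w * F (node n (i - 1) + mesh n * \<xi>)) q =
         map (\<lambda>(\<xi>, w). w * G (node n (i - 1) + mesh n * \<xi>)) q"
    by (intro map_cong) auto
  thus ?thesis unfolding quad_def by (simp only:)
qed

text \<open>The order condition for functions with explicitly listed derivatives. It also replaces the constant
  by a nonnegative one, which the maximum of suprema allows since it is nonnegative itself.\<close>

lemma quad_error_bound:
  assumes "quadrature_order q m"
  shows "\<exists>CQ\<ge>0. \<forall>n\<ge>2. \<forall>i\<in>{1..n}. \<forall>D A. deriv_chain {node n (i - 1)..node n i} (m + 1) D \<longrightarrow>
      (\<forall>k\<le>m + 1. \<forall>x\<in>{node n (i - 1)..node n i}. \<bar>D k x\<bar> \<le> A) \<longrightarrow>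
      \<bar>quad_error q n i (D 0)\<bar> \<le> CQ * mesh n ^ (m + 1) * A"
proof -
  obtain C where C: "\<And>n i F. \<lbrakk>n \<ge> 2; i \<in> {1..n}; Ck_on (m + 1) F {node n (i - 1)..node n i}\<rbrakk> \<Longrightarrow>
        \<bar>integral {node n (i - 1)..node n i} F - quad q n i F\<bar>
          \<le> C * mesh n ^ (m + 1) *
             (MAX k\<in>{0..m + 1}. SUP x\<in>{node n (i - 1)..node n i}.
                \<bar>iter_deriv {node n (i - 1)..node n i} k F x\<bar>)"
    using assms unfolding quadrature_order_def by blast
  show ?thesis
  proof (intro exI[of _ "\<bar>C\<bar>"] conjI allI ballI impI)
    fix n :: nat and i D A
    assume n: "n \<ge> 2" and i: "i \<in> {1..n}"
      and D: "deriv_chain {node n (i - 1)..node n i} (m + 1) D"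
      and A: "\<forall>k\<le>m + 1. \<forall>x\<in>{node n (i - 1)..node n i}. \<bar>D k x\<bar> \<le> A"
    let ?S = "{node n (i - 1)..node n i}"
    have h: "mesh n > 0" using n mesh_pos by simp
    have lt: "node n (i - 1) < node n i" using node_prev[of i n] i h by simp
    define s where "s = (\<lambda>k. SUP x\<in>?S. \<bar>iter_deriv ?S k (D 0) x\<bar>)"
    have s: "0 \<le> s k \<and> s k \<le> A" if k: "k \<le> m + 1" for k
    proof -
      have e: "\<bar>iter_deriv ?S k (D 0) x\<bar> \<le> A" if "x \<in> ?S" for x
        using iter_deriv_eq_chain[OF lt D k that] A k that by simp
      have x: "node n i \<in> ?S" using lt by simp
      have "\<bar>iter_deriv ?S k (D 0) (node n i)\<bar> \<le> s k"
        unfolding s_def by (rule cSUP_upper[OF x]) (rule bdd_aboveI2, rule e)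
      moreover have "s k \<le> A" unfolding s_def by (rule cSUP_least) (use x e in auto)
      ultimately show ?thesis by linarith
    qed
    define M where "M = (MAX k\<in>{0..m + 1}. s k)"
    have "M \<in> s ` {0..m + 1}" unfolding M_def by (rule Max_in) auto
    hence M: "0 \<le> M" "M \<le> A" using s by auto
    have "\<bar>quad_error q n i (D 0)\<bar> \<le> C * mesh n ^ (m + 1) * M"
      using C[OF n i Ck_on_chain[OF lt D]] unfolding quad_error_def M_def s_def .
    also have "\<dots> \<le> \<bar>C\<bar> * mesh n ^ (m + 1) * A"
      using M h by (intro mult_mono) auto
    finally show "\<bar>quad_error q n i (D 0)\<bar> \<le> \<bar>C\<bar> * mesh n ^ (m + 1) * A" .
  qed simp
qed

text \<open>Taking the factor \<open>K\<close> out leaves two functions whose derivatives are bounded uniformly in the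
  mesh.\<close>

lemma quad_error_cell_test:
  assumes "continuous_on {node n (i - 1)..node n i} f"
  shows "quad_error q n i (\<lambda>x. f x * cell_test \<epsilon> n i x) =
     bubble_const \<epsilon> (mesh n) * (quad_error q n i f
       - quad_error q n i (\<lambda>x. exp (- (1 / \<epsilon>) * (x - node n (i - 1))) * f x))"
proof -
  let ?e = "\<lambda>x. exp (- (1 / \<epsilon>) * (x - node n (i - 1))) * f x"
  have int: "f integrable_on {node n (i - 1)..node n i}" "?e integrable_on {node n (i - 1)..node n i}"
    by (intro integrable_continuous_real continuous_intros assms)+
  have "(\<lambda>x. f x * cell_test \<epsilon> n i x) = (\<lambda>x. bubble_const \<epsilon> (mesh n) * (f x - ?e x))"
    by (rule ext) (simp add: cell_test_def algebra_simps flip: add_divide_distrib diff_divide_distrib)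
  hence "quad_error q n i (\<lambda>x. f x * cell_test \<epsilon> n i x) =
      quad_error q n i (\<lambda>x. bubble_const \<epsilon> (mesh n) * (f x - ?e x))" by simp
  also have "\<dots> = bubble_const \<epsilon> (mesh n) * (quad_error q n i f - quad_error q n i ?e)"
    unfolding quad_error_def quad_cmult quad_diff integral_mult_right integral_diff[OF int]
    by (simp only: right_diff_distrib)
  finally show ?thesis .
qed

lemma quad_error_cell_bounds:
  assumes "\<epsilon> > 0" "quadrature_order q m" "Ck_on (m + 1) f {0..1}"
  obtains C where "C \<ge> 0"
    "\<And>n i. \<lbrakk>n \<ge> 2; i \<in> {1..n}\<rbrakk> \<Longrightarrow> \<bar>quad_error q n i f\<bar> \<le> C * mesh n ^ (m + 1)"
    "\<And>n i. \<lbrakk>n \<ge> 2; i \<in> {1..n}\<rbrakk> \<Longrightarrow>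
       \<bar>quad_error q n i (\<lambda>x. f x * cell_test \<epsilon> n i x)\<bar> \<le> C * mesh n ^ m"
proof -
  obtain CQ where CQ: "CQ \<ge> 0" and CQ': "\<forall>n\<ge>2. \<forall>i\<in>{1..n}. \<forall>D A.
      deriv_chain {node n (i - 1)..node n i} (m + 1) D \<longrightarrow>
      (\<forall>k\<le>m + 1. \<forall>x\<in>{node n (i - 1)..node n i}. \<bar>D k x\<bar> \<le> A) \<longrightarrow>
      \<bar>quad_error q n i (D 0)\<bar> \<le> CQ * mesh n ^ (m + 1) * A"
    using quad_error_bound[OF assms(2)] by (elim exE conjE)
  define D where "D = (\<lambda>k. iter_deriv {0..1} k f)"
  have D: "deriv_chain {0..1} (m + 1) D"
    unfolding D_def by (rule deriv_chain_iter_deriv[OF assms(3)])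
  have D0: "D 0 = f" by (simp add: D_def)
  obtain A where A: "A \<ge> 0" "\<And>k x. k \<le> m + 1 \<Longrightarrow> x \<in> {0..1} \<Longrightarrow> \<bar>D k x\<bar> \<le> A"
    by (rule deriv_chain_bounded[OF D], rule that; blast)
  define a where "a = 1 / \<epsilon>"
  have a: "a \<ge> 0" using assms(1) by (simp add: a_def)
  \<comment> \<open>\<open>R\<close> bounds the derivatives of \<open>f\<close> and of \<open>exp (- a (x - x\<^bsub>i-1\<^esub>)) f(x)\<close>; the latter because the
    exponential starts at the left end of the cell and is at most 1 there.\<close>
  define R where "R = (1 + a) ^ (m + 1) * A"
  have pw: "(1 + a) ^ k * A \<le> R" if "k \<le> m + 1" for k
    unfolding R_def using that a A(1) by (intro mult_right_mono power_increasing) auto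
  have R: "R \<ge> 0" "A \<le> R" using pw[of 0] A(1) by auto
  \<comment> \<open>The summand 1 is for \<open>f\<close> alone; two errors times \<open>K \<le> (1 + \<epsilon>) / h\<close> give the other one.\<close>
  define C where "C = CQ * R * (1 + 2 * (1 + \<epsilon>))"
  have CQR: "CQ * R \<le> C" "0 \<le> CQ * R"
    using CQ R(1) assms(1) by (auto simp: C_def algebra_simps)
  have Ef: "\<bar>quad_error q n i f\<bar> \<le> CQ * R * mesh n ^ (m + 1)"
    and Ee: "\<bar>quad_error q n i (\<lambda>x. exp (- a * (x - node n (i - 1))) * f x)\<bar> \<le> CQ * R * mesh n ^ (m + 1)"
    if n: "n \<ge> 2" and i: "i \<in> {1..n}" for n i
  proof -
    note sub = cell_subset[OF i]
    note chain = deriv_chain_subset[OF D sub]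
    have "\<bar>quad_error q n i (D 0)\<bar> \<le> CQ * mesh n ^ (m + 1) * R"
      by (rule CQ'[rule_format, OF n i chain]) (rule order_trans[OF A(2) R(2)], use sub in auto)
    thus "\<bar>quad_error q n i f\<bar> \<le> CQ * R * mesh n ^ (m + 1)" by (simp only: D0 ac_simps)
    have "\<bar>quad_error q n i (\<lambda>x. exp (- a * (x - node n (i - 1))) * shifted_deriv a D 0 0 x)\<bar>
        \<le> CQ * mesh n ^ (m + 1) * R"
    proof (rule CQ'[rule_format, OF n i deriv_chain_exp_mult[OF chain]])
      fix k x assume k: "k \<le> m + 1" and x: "x \<in> {node n (i - 1)..node n i}"
      have "\<bar>shifted_deriv a D k 0 x\<bar> \<le> (1 + a) ^ k * A"
        by (rule shifted_deriv_bound[OF a, of "m + 1"]) (use A(2) x sub k in auto)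
      also note pw[OF k]
      finally have "\<bar>shifted_deriv a D k 0 x\<bar> \<le> R" .
      moreover have "exp (- a * (x - node n (i - 1))) \<le> 1" using a x by simp
      ultimately have "exp (- a * (x - node n (i - 1))) * \<bar>shifted_deriv a D k 0 x\<bar> \<le> 1 * R"
        by (intro mult_mono) auto
      thus "\<bar>exp (- a * (x - node n (i - 1))) * shifted_deriv a D k 0 x\<bar> \<le> R"
        by (simp add: abs_mult)
    qed
    thus "\<bar>quad_error q n i (\<lambda>x. exp (- a * (x - node n (i - 1))) * f x)\<bar> \<le> CQ * R * mesh n ^ (m + 1)"
      by (simp only: shifted_deriv.simps D0 ac_simps)
  qed
  show ?thesis
  proof (rule that[of C])
    show "C \<ge> 0" using CQR by linarith
    fix n i assume n: "n \<ge> (2::nat)" and i: "i \<in> {1..n}"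
    have h: "mesh n > 0" "mesh n \<le> 1" using n by (auto simp: mesh_def)
    have "CQ * R * mesh n ^ (m + 1) \<le> C * mesh n ^ (m + 1)"
      using CQR(1) h by (intro mult_right_mono) auto
    thus "\<bar>quad_error q n i f\<bar> \<le> C * mesh n ^ (m + 1)" using Ef[OF n i] by linarith
    define K where "K = bubble_const \<epsilon> (mesh n)"
    have K: "0 \<le> K" "K \<le> (1 + \<epsilon>) / mesh n"
      using bubble_const_bound[OF assms(1) h] by (auto simp: K_def)
    have "continuous_on {node n (i - 1)..node n i} f"
      using deriv_chain_continuous[OF D, of 0] cell_subset[OF i] by (auto simp: D0 intro: continuous_on_subset)
    hence "\<bar>quad_error q n i (\<lambda>x. f x * cell_test \<epsilon> n i x)\<bar> = K * \<bar>quad_error q n i f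
       - quad_error q n i (\<lambda>x. exp (- a * (x - node n (i - 1))) * f x)\<bar>"
      using K(1) by (simp add: quad_error_cell_test abs_mult K_def a_def)
    also have "\<dots> \<le> (1 + \<epsilon>) / mesh n * (2 * (CQ * R * mesh n ^ (m + 1)))"
      using Ef[OF n i] Ee[OF n i] K assms(1) h by (intro mult_mono) auto
    also have "\<dots> = 2 * (1 + \<epsilon>) * (CQ * R) * mesh n ^ m" using h by simp
    also have "\<dots> \<le> C * mesh n ^ m"
      using CQR(2) h by (intro mult_right_mono) (auto simp: C_def algebra_simps)
    finally show "\<bar>quad_error q n i (\<lambda>x. f x * cell_test \<epsilon> n i x)\<bar> \<le> C * mesh n ^ m" .
  qed
qed


section \<open>The error estimate\<close>

lemma fd_rhs_cells:
  assumes "\<epsilon> > 0" "quadrature_rule q" "j \<in> {1..n-1}"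
  shows "fd_rhs \<epsilon> f q n j = quad q n j (\<lambda>x. f x * cell_test \<epsilon> n j x)
     + (quad q n (j + 1) f - quad q n (j + 1) (\<lambda>x. f x * cell_test \<epsilon> n (j + 1) x))"
proof -
  have j: "j \<in> {1..n}" "j + 1 \<in> {1..n}" using assms(3) by auto
  have "quad q n j (\<lambda>x. f x * test_fun \<epsilon> n j x) = quad q n j (\<lambda>x. f x * cell_test \<epsilon> n j x)"
    by (rule quad_cong[OF assms(2) j(1)]) (simp add: test_fun_on_cell(1)[OF assms(1) j(1)])
  moreover have "quad q n (j + 1) (\<lambda>x. f x * test_fun \<epsilon> n j x) =
      quad q n (j + 1) (\<lambda>x. f x - f x * cell_test \<epsilon> n (j + 1) x)"
    by (rule quad_cong[OF assms(2) j(2)])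
       (use assms(3) in \<open>simp add: test_fun_on_cell(2)[OF assms(1) j(2), simplified] algebra_simps\<close>)
  ultimately show ?thesis by (simp add: fd_rhs_def quad_diff)
qed

text \<open>The equations for the error have right-hand side \<open>E\<^sub>j(f \<phi>\<^sub>j) + E\<^bsub>j+1\<^esub>(f) - E\<^bsub>j+1\<^esub>(f \<phi>\<^bsub>j+1\<^esub>)\<close>: the values
  of \<open>z\<close> cancel. Summing by parts from the nodes back to the cells, now with the errors in place of the
  discrete fluxes, puts each \<open>E\<^sub>i(f \<phi>\<^sub>i)\<close> next to a difference of \<open>w\<close>.\<close>

lemma upwind_form_error:
  assumes "\<epsilon> > 0" "n \<ge> 2" "dirichlet_solution \<epsilon> 1 f 1 u" "continuous_on {0..1} f" "quadrature_rule q"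
    and U: "\<And>j. j \<in> {1..n-1} \<Longrightarrow> (\<Sum>k=1..n-1. fd_matrix \<epsilon> n j k * U k) = fd_rhs \<epsilon> f q n j"
    and bc: "U 0 = 0" "U n = 0" "w 0 = 0" "w n = 0"
  shows "upwind_form \<epsilon> n (lin_comb n (\<lambda>j. u (node n j) - U j)) (lin_comb n w) =
     (\<Sum>i=1..n. (w i - w (i - 1)) * quad_error q n i (\<lambda>x. f x * cell_test \<epsilon> n i x)
              + w (i - 1) * quad_error q n i f)"
proof -
  obtain z where z: "continuous_on {0..1} z"
    "\<And>x. x \<in> {0<..<1} \<Longrightarrow> (z has_real_derivative f x) (at x)"
    "\<And>x. x \<in> {0<..<1} \<Longrightarrow> (u has_real_derivative (u x - z x) / \<epsilon>) (at x)"
    by (rule flux_of_solution[OF assms(1,3,4)], rule that; blast)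
  have u: "continuous_on {0..1} u" "u 0 = 0" "u 1 = 0"
    using assms(3) by (auto simp: dirichlet_solution_def)
  have n: "n \<ge> 1" using assms(2) by simp
  define e where "e = (\<lambda>j. u (node n j) - U j)"
  have e0: "e 0 = 0" "e n = 0" using u bc n by (auto simp: e_def node_0 node_last)
  define S where "S = upwind_flux \<epsilon> n"
  define E where "E = (\<lambda>i. quad_error q n i f)"
  define E\<phi> where "E\<phi> = (\<lambda>i. quad_error q n i (\<lambda>x. f x * cell_test \<epsilon> n i x))"
  have S: "S e i = S (\<lambda>j. u (node n j)) i - S U i" for i
    by (simp add: S_def e_def upwind_flux_def algebra_simps)
  have row: "S e j - S e (j + 1) = E\<phi> j - (E\<phi> (j + 1) - E (j + 1))" if j: "j \<in> {1..n-1}" for j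
  proof -
    have j': "j \<in> {1..n}" "j + 1 \<in> {1..n}" using j by auto
    have "S U j - S U (j + 1) = fd_rhs \<epsilon> f q n j"
      using fd_matrix_row[OF assms(1) j bc(1,2)] U[OF j] by (simp add: S_def)
    moreover note fd_rhs_cells[OF assms(1,5) j, of f]
    moreover note integral_on_cell(2)[OF assms(1) j'(1) u(1) z, folded S_def]
    moreover note integral_on_cell[OF assms(1) j'(2) u(1) z, folded S_def, unfolded add_diff_cancel_right']
    ultimately show ?thesis
      unfolding S E_def E\<phi>_def quad_error_def add_diff_cancel_right' by linarith
  qed
  have "upwind_form \<epsilon> n (lin_comb n e) (lin_comb n w) = (\<Sum>i=1..n. w i * S e i - w (i - 1) * S e i)"
    unfolding S_def upwind_form_lin_comb[OF assms(1) n e0 bc(3,4)] by (simp only: left_diff_distrib)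
  also have "\<dots> = (\<Sum>j=1..n-1. w j * (S e j - S e (j + 1)))"
    by (rule summation_by_parts[OF n bc(3,4), symmetric])
  also have "\<dots> = (\<Sum>j=1..n-1. w j * (E\<phi> j - (E\<phi> (j + 1) - E (j + 1))))"
    by (rule sum.cong[OF refl]) (simp only: row)
  also have "\<dots> = (\<Sum>i=1..n. w i * E\<phi> i - w (i - 1) * (E\<phi> i - E i))"
    by (rule summation_by_parts[OF n bc(3,4), of E\<phi> "\<lambda>i. E\<phi> i - E i"])
  also have "\<dots> = (\<Sum>i=1..n. (w i - w (i - 1)) * E\<phi> i + w (i - 1) * E i)"
    by (rule sum.cong[OF refl]) (simp only: left_diff_distrib right_diff_distrib)
  finally show ?thesis by (simp only: e_def E_def E\<phi>_def)
qed

lemma pl_interp_eq_lin_comb: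
  assumes "n \<ge> 1" "u 0 = 0" "u 1 = 0"
  shows "pl_interp n u = lin_comb n (\<lambda>j. u (node n j))"
proof
  fix x
  show "pl_interp n u x = lin_comb n (\<lambda>j. u (node n j)) x"
    unfolding pl_interp_def lin_comb_def
    using sum_interior[of "\<lambda>j. u (node n j) * hat n j x" n] node_last[OF assms(1)] assms(2,3)
    by (simp add: node_0)
qed

text \<open>The supremum is over a nonempty set, since the trial space contains a hat function when
  \<open>n \<ge> 2\<close>. Stating the bound as a product makes \<open>w\<close> with vanishing seminorm harmless.\<close>

lemma optimal_norm_le:
  assumes "n \<ge> 2" "B \<ge> 0"
    and "\<And>w. w 0 = 0 \<Longrightarrow> w n = 0 \<Longrightarrow>
      upwind_form \<epsilon> n v (lin_comb n w) \<le> B * h1_seminorm (lin_comb n w)"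
  shows "optimal_norm \<epsilon> n v \<le> B"
  unfolding optimal_norm_def
proof (rule cSUP_least)
  define c :: "nat \<Rightarrow> real" where "c = (\<lambda>j. if j = 1 then 1 else 0)"
  have "lin_comb n c (node n 1) = (\<Sum>j=1..n-1. if j = 1 then 1 else 0)"
    unfolding lin_comb_def by (rule sum.cong) (use assms(1) in \<open>auto simp: hat_node c_def\<close>)
  also have "\<dots> = 1" using assms(1) by (subst sum.delta) auto
  finally have "lin_comb n c \<noteq> (\<lambda>_. 0)" by (metis zero_neq_one)
  thus "trial_space n - {\<lambda>_. 0} \<noteq> {}" by (auto simp: trial_space_def)
next
  fix w assume "w \<in> trial_space n - {\<lambda>_. 0}"
  then obtain c where c: "w = lin_comb n c" by (auto simp: trial_space_def)
  have le: "upwind_form \<epsilon> n v w \<le> B * h1_seminorm w"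
    unfolding c by (subst (1 2) lin_comb_zero_extension) (rule assms(3); use assms(1) in simp)
  have "integral {0..1} (\<lambda>x. (deriv w x)\<^sup>2) \<ge> 0"
    by (cases "(\<lambda>x. (deriv w x)\<^sup>2) integrable_on {0..1}")
       (auto intro: integral_nonneg simp: not_integrable_integral)
  hence "h1_seminorm w \<ge> 0" by (simp add: h1_seminorm_def)
  thus "upwind_form \<epsilon> n v w / h1_seminorm w \<le> B"
    using le assms(2) by (cases "h1_seminorm w = 0") (auto simp: divide_le_eq)
qed

theorem theorem6p2:
  fixes \<epsilon> :: real and m :: nat and f u :: "real \<Rightarrow> real" and q :: "(real \<times> real) list"
  assumes "\<epsilon> > 0"
    and "m \<ge> 1"
    and "Ck_on (m + 1) f {0..1}"
    and "dirichlet_solution \<epsilon> 1 f 1 u"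
    and "quadrature_rule q"
    and "quadrature_order q m"
  shows "\<exists>C. \<forall>n\<ge>2. \<forall>uh. fd_solution \<epsilon> f q n uh \<longrightarrow>
           optimal_norm \<epsilon> n (\<lambda>x. pl_interp n u x - uh x) \<le> C * mesh n ^ m"
proof -
  obtain C where C: "C \<ge> 0"
    "\<And>n i. \<lbrakk>n \<ge> 2; i \<in> {1..n}\<rbrakk> \<Longrightarrow> \<bar>quad_error q n i f\<bar> \<le> C * mesh n ^ (m + 1)"
    "\<And>n i. \<lbrakk>n \<ge> 2; i \<in> {1..n}\<rbrakk> \<Longrightarrow>
       \<bar>quad_error q n i (\<lambda>x. f x * cell_test \<epsilon> n i x)\<bar> \<le> C * mesh n ^ m"
    by (rule quad_error_cell_bounds[OF assms(1,6,3)], rule that; blast)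
  have contf: "continuous_on {0..1} f" 
    using deriv_chain_continuous[OF deriv_chain_iter_deriv[OF assms(3)], of 0] by simp
  have u: "u 0 = 0" "u 1 = 0" using assms(4) by (auto simp: dirichlet_solution_def)
  show ?thesis
  proof (intro exI[of _ "2 * C"] allI impI)
    fix n uh assume n: "n \<ge> (2::nat)" and "fd_solution \<epsilon> f q n uh"
    then obtain V where V: "\<forall>j\<in>{1..n-1}. (\<Sum>k=1..n-1. fd_matrix \<epsilon> n j k * V k) = fd_rhs \<epsilon> f q n j"
      "uh = lin_comb n V"
      by (auto simp: fd_solution_def)
    \<comment> \<open>The values of \<open>V\<close> at the boundary indices are arbitrary; zero is the one that matches \<open>u\<close>.\<close>
    define U where "U = (\<lambda>j. if j \<in> {1..n - 1} then V j else 0)"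
    have U0: "U 0 = 0" "U n = 0" using n by (auto simp: U_def)
    have U: "(\<Sum>k=1..n-1. fd_matrix \<epsilon> n j k * U k) = fd_rhs \<epsilon> f q n j" if "j \<in> {1..n-1}" for j
    proof -
      have "(\<Sum>k=1..n-1. fd_matrix \<epsilon> n j k * U k) = (\<Sum>k=1..n-1. fd_matrix \<epsilon> n j k * V k)"
        by (rule sum.cong) (auto simp: U_def)
      thus ?thesis using V(1) that by simp
    qed
    have uh: "uh = lin_comb n U" unfolding V(2) U_def by (rule lin_comb_zero_extension)
    have err: "(\<lambda>x. pl_interp n u x - uh x) = lin_comb n (\<lambda>j. u (node n j) - U j)"
      using pl_interp_eq_lin_comb[of n u] n u
      by (auto simp: uh lin_comb_def sum_subtractf left_diff_distrib)
    have h: "mesh n > 0" "real n * mesh n = 1" using n by (auto simp: mesh_def)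
    show "optimal_norm \<epsilon> n (\<lambda>x. pl_interp n u x - uh x) \<le> 2 * C * mesh n ^ m"
      unfolding err
    proof (rule optimal_norm_le[OF n])
      show "0 \<le> 2 * C * mesh n ^ m" using C(1) h by simp
      fix w :: "nat \<Rightarrow> real" assume w: "w 0 = 0" "w n = 0"
      define s where "s = h1_seminorm (lin_comb n w)"
      have var: "(\<Sum>i=1..n. \<bar>w i - w (i - 1)\<bar>) \<le> s"
        unfolding s_def by (rule nodal_variation_le_h1_seminorm) (use n w in auto)
      have val: "\<bar>w k\<bar> \<le> s" if "k \<le> n" for k
        using nodal_value_le_variation[of w k n] w that var by linarith
      have "upwind_form \<epsilon> n (lin_comb n (\<lambda>j. u (node n j) - U j)) (lin_comb n w) =
          (\<Sum>i=1..n. (w i - w (i - 1)) * quad_error q n i (\<lambda>x. f x * cell_test \<epsilon> n i x)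
              + w (i - 1) * quad_error q n i f)"
        by (rule upwind_form_error) (use assms n contf U U0 w in auto)
      \<comment> \<open>The first terms add up to \<open>O(h ^ m) s\<close> by the variation bound, the second ones because
        \<open>n\<close> terms of size \<open>h ^ (m + 1)\<close> sum to \<open>h ^ m\<close>.\<close>
      also have "\<dots> \<le> (\<Sum>i=1..n. \<bar>w i - w (i - 1)\<bar> * (C * mesh n ^ m) + s * (C * mesh n ^ (m + 1)))"
      proof (rule sum_mono, rule add_mono)
        fix i assume i: "i \<in> {1..n}"
        show "(w i - w (i - 1)) * quad_error q n i (\<lambda>x. f x * cell_test \<epsilon> n i x)
            \<le> \<bar>w i - w (i - 1)\<bar> * (C * mesh n ^ m)"
          by (rule order_trans[OF abs_ge_self], unfold abs_mult)
             (intro mult_left_mono C(3) n i abs_ge_zero)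
        have s0: "0 \<le> s" using val[of 0] by simp
        show "w (i - 1) * quad_error q n i f \<le> s * (C * mesh n ^ (m + 1))"
          by (rule order_trans[OF abs_ge_self], unfold abs_mult)
             (intro mult_mono C(2) n i val s0 abs_ge_zero; use i in auto)
      qed
      also have "\<dots> = (\<Sum>i=1..n. \<bar>w i - w (i - 1)\<bar>) * (C * mesh n ^ m) + (real n * mesh n) * (s * (C * mesh n ^ m))"
        by (simp add: sum.distrib sum_distrib_right)
      also have "\<dots> \<le> s * (C * mesh n ^ m) + s * (C * mesh n ^ m)"
        unfolding h(2) mult_1
        by (intro add_mono mult_right_mono var order_refl) (use C(1) h in simp)
      finally show "upwind_form \<epsilon> n (lin_comb n (\<lambda>j. u (node n j) - U j)) (lin_comb n w)
          \<le> 2 * C * mesh n ^ m * h1_seminorm (lin_comb n w)"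
        by (simp add: s_def algebra_simps)
    qed
  qed
qed

end
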